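(* Let $d\ge 1$, let $\mathcal{H}=L_2(\mathbb{R}^d)$ be the complex Hilbert space of square-integrable functions with respect to Lebesgue measure, and let $u\in\mathcal{H}$. Let $\{\xi_n\}_{n\ge 1}$ be independent identically distributed random vectors in $\mathbb{R}^d$, defined on a common probability space $(\Omega,\mathcal{F},\mathrm{P})$, with expectation $\mu\in\mathbb{R}^d$. Then the random pure states $\rho\left[S_{\xi_1/n}\cdots S_{\xi_n/n}u\right]$ converge in the weak operator topology in $L_1(\mathrm{P})$ to the pure state $\rho[S_\mu u]$; that is, for every bounded linear operator $A\in B(\mathcal{H})$, $$\mathbb{E}\left|\operatorname{tr}\left(\rho\left[S_{\xi_1/n}\cdots S_{\xi_n/n}u\right]A\right)-\operatorname{tr}\left(\rho[S_\mu u]A\right)\right|\xrightarrow[n\to\infty]{}0.$$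
   Context: For $a\in\mathbb{R}^d$, the shift operator $S_a:\mathcal{H}\to\mathcal{H}$ is $(S_a u)(x):=u(x+a)$. For $u\in\mathcal{H}$ (not necessarily of norm one), the pure state $\rho[u]:=|u\rangle\langle u|$ is the trace-class operator $v\mapsto\langle u,v\rangle u$, where $\langle\cdot,\cdot\rangle$ is the inner product of $\mathcal{H}$, linear in the second argument. $B(\mathcal{H})$ is the space of bounded linear operators on $\mathcal{H}$. Random states $\rho_n$ converge in the weak operator topology in $L_1(\mathrm{P})$ to $\rho$ if for each $A\in B(\mathcal{H})$ the random variables $\operatorname{tr}(\rho_nA)$ converge to $\operatorname{tr}(\rho A)$ in $L_1(\mathrm{P})$. $\mathbb{E}$ denotes expected value. *)

theory Defs
  imports "HOL-Probability.Probability"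
begin

definition sq_int :: "('a::euclidean_space \<Rightarrow> complex) \<Rightarrow> bool" where
  "sq_int f \<longleftrightarrow> f \<in> borel_measurable lebesgue \<and> integrable lebesgue (\<lambda>x. (cmod (f x))\<^sup>2)"

definition l2_rel :: "('a::euclidean_space \<Rightarrow> complex) \<Rightarrow> ('a \<Rightarrow> complex) \<Rightarrow> bool" where
  "l2_rel f g \<longleftrightarrow> sq_int f \<and> sq_int g \<and> (AE x in lebesgue. f x = g x)"

lemma sq_int_measurable [measurable_dest]: "sq_int f \<Longrightarrow> f \<in> borel_measurable lebesgue"
  by (simp add: sq_int_def)

lemma sq_int_integrable: "sq_int f \<Longrightarrow> integrable lebesgue (\<lambda>x. (cmod (f x))\<^sup>2)"
  by (simp add: sq_int_def)

lemma sq_int_zero: "sq_int (\<lambda>x. 0)"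
  by (simp add: sq_int_def)

lemma sq_int_add:
  assumes f: "sq_int f" and g: "sq_int g"
  shows "sq_int (\<lambda>x. f x + g x)"
proof -
  note [measurable] = sq_int_measurable[OF f] sq_int_measurable[OF g]
  have bound: "(cmod (f x + g x))\<^sup>2 \<le> 2 * (cmod (f x))\<^sup>2 + 2 * (cmod (g x))\<^sup>2" for x
  proof -
    have "(cmod (f x + g x))\<^sup>2 \<le> (cmod (f x) + cmod (g x))\<^sup>2"
      by (simp add: norm_triangle_ineq power_mono)
    also have "\<dots> \<le> 2 * (cmod (f x))\<^sup>2 + 2 * (cmod (g x))\<^sup>2"
      using sum_squares_bound[of "cmod (f x)" "cmod (g x)"] by (simp add: power2_sum)
    finally show ?thesis .
  qed
  have "integrable lebesgue (\<lambda>x. (cmod (f x + g x))\<^sup>2)"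
    by (rule Bochner_Integration.integrable_bound
        [where f = "\<lambda>x. 2 * (cmod (f x))\<^sup>2 + 2 * (cmod (g x))\<^sup>2"])
      (use bound sq_int_integrable[OF f] sq_int_integrable[OF g] in auto)
  then show ?thesis
    by (simp add: sq_int_def)
qed

lemma sq_int_cmult:
  assumes f: "sq_int f"
  shows "sq_int (\<lambda>x. c * f x)"
proof -
  note [measurable] = sq_int_measurable[OF f]
  have "(\<lambda>x. c * f x) \<in> borel_measurable lebesgue"
    by measurable
  then show ?thesis
    using sq_int_integrable[OF f] by (simp add: sq_int_def norm_mult power_mult_distrib)
qed

lemma integrable_cnj_mult:
  assumes f: "sq_int f" and g: "sq_int g"
  shows "integrable lebesgue (\<lambda>x. cnj (f x) * g x)"
proof -
  note [measurable] = sq_int_measurable[OF f] sq_int_measurable[OF g]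
  have bound: "cmod (f x) * cmod (g x) \<le> (cmod (f x))\<^sup>2 + (cmod (g x))\<^sup>2" for x
  proof -
    have "0 \<le> cmod (f x) * cmod (g x)"
      by simp
    with sum_squares_bound[of "cmod (f x)" "cmod (g x)"] show ?thesis
      by linarith
  qed
  have [measurable]: "(\<lambda>x. cnj (f x)) \<in> borel_measurable lebesgue"
    using measurable_compose[OF sq_int_measurable[OF f], of cnj borel]
    by (simp add: borel_measurable_continuous_onI continuous_on_cnj)
  show ?thesis
    by (rule Bochner_Integration.integrable_bound
        [where f = "\<lambda>x. (cmod (f x))\<^sup>2 + (cmod (g x))\<^sup>2"])
      (use bound sq_int_integrable[OF f] sq_int_integrable[OF g] in \<open>auto simp: norm_mult\<close>)
qed

lemma lebesgue_measurable_shift [measurable]: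
  "(\<lambda>x::'a::euclidean_space. x + a) \<in> lebesgue \<rightarrow>\<^sub>M lebesgue"
  using lebesgue_affine_measurable[of "\<lambda>_. 1" a]
  by (simp add: euclidean_representation add.commute)

lemma lebesgue_distr_shift:
  "distr lebesgue lebesgue (\<lambda>x::'a::euclidean_space. x + a) = lebesgue"
  using lebesgue_affine_euclidean[of "\<lambda>_. 1" a]
  by (simp add: euclidean_representation add.commute density_1)

lemma AE_lebesgue_shift:
  assumes "AE x in lebesgue. P x"
  shows "AE x in lebesgue. P (x + a)"
proof -
  have "AE x in distr lebesgue lebesgue (\<lambda>x. x + a). P x"
    using assms by (simp only: lebesgue_distr_shift)
  then show ?thesis
    by (rule AE_distrD[OF lebesgue_measurable_shift])
qed

lemma sq_int_shift:
  assumes f: "sq_int f"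
  shows "sq_int (\<lambda>x. f (x + a))"
proof -
  have "integrable (distr lebesgue lebesgue (\<lambda>x. x + a)) (\<lambda>x. (cmod (f x))\<^sup>2)"
    using sq_int_integrable[OF f] by (simp only: lebesgue_distr_shift)
  then have "integrable lebesgue (\<lambda>x. (cmod (f (x + a)))\<^sup>2)"
    by (rule integrable_distr[OF lebesgue_measurable_shift])
  moreover have "(\<lambda>x. f (x + a)) \<in> borel_measurable lebesgue"
    by (rule measurable_compose[OF lebesgue_measurable_shift sq_int_measurable[OF f]])
  ultimately show ?thesis
    by (simp add: sq_int_def)
qed

lemma part_equivp_l2_rel: "part_equivp (l2_rel :: ('a::euclidean_space \<Rightarrow> complex) \<Rightarrow> _)"
  (is "part_equivp ?R")
proof (rule part_equivpI)
  show "\<exists>f. ?R f f"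
    using sq_int_zero by (auto simp: l2_rel_def)
  show "symp ?R"
    by (rule sympI) (auto simp: l2_rel_def)
  show "transp ?R"
  proof (rule transpI)
    fix f g h :: "'a \<Rightarrow> complex"
    assume *: "l2_rel f g" "l2_rel g h"
    then have "AE x in lebesgue. f x = g x" "AE x in lebesgue. g x = h x"
      by (simp_all add: l2_rel_def)
    then have "AE x in lebesgue. f x = h x"
      by eventually_elim simp
    with * show "l2_rel f h"
      by (simp add: l2_rel_def)
  qed
qed

quotient_type (overloaded) 'a L2 = "'a::euclidean_space \<Rightarrow> complex" / partial: l2_rel
  by (rule part_equivp_l2_rel)

lift_definition cinner :: "'a::euclidean_space L2 \<Rightarrow> 'a L2 \<Rightarrow> complex"
  is "\<lambda>f g. \<integral>x. cnj (f x) * g x \<partial>lebesgue"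
proof -
  fix f f' g g' :: "'a \<Rightarrow> complex"
  assume r: "l2_rel f f'" "l2_rel g g'"
  have "AE x in lebesgue. f x = f' x" "AE x in lebesgue. g x = g' x"
    using r by (auto simp: l2_rel_def)
  then have ae: "AE x in lebesgue. cnj (f x) * g x = cnj (f' x) * g' x"
    by eventually_elim simp
  have "integrable lebesgue (\<lambda>x. cnj (f x) * g x)" "integrable lebesgue (\<lambda>x. cnj (f' x) * g' x)"
    using r integrable_cnj_mult by (auto simp: l2_rel_def)
  with ae show "(\<integral>x. cnj (f x) * g x \<partial>lebesgue) = (\<integral>x. cnj (f' x) * g' x \<partial>lebesgue)"
    by (intro integral_cong_AE) (auto dest: borel_measurable_integrable)
qed

lift_definition scaleC :: "complex \<Rightarrow> 'a::euclidean_space L2 \<Rightarrow> 'a L2"  (infixr \<open>*\<^sub>C\<close> 75)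
  is "\<lambda>c f x. c * f x"
  by (auto simp: l2_rel_def intro: sq_int_cmult elim!: eventually_mono)

lift_definition shift_op :: "'a::euclidean_space \<Rightarrow> 'a L2 \<Rightarrow> 'a L2"
  is "\<lambda>a f x. f (x + a)"
proof -
  fix a :: 'a and f g :: "'a \<Rightarrow> complex"
  assume r: "l2_rel f g"
  then have "AE x in lebesgue. f x = g x"
    by (simp add: l2_rel_def)
  from AE_lebesgue_shift[OF this] r show "l2_rel (\<lambda>x. f (x + a)) (\<lambda>x. g (x + a))"
    by (simp add: l2_rel_def sq_int_shift)
qed

instantiation L2 :: (euclidean_space) real_vector
begin

lift_definition zero_L2 :: "'a L2" is "\<lambda>x. 0"
  by (simp add: l2_rel_def sq_int_zero)

lift_definition plus_L2 :: "'a L2 \<Rightarrow> 'a L2 \<Rightarrow> 'a L2" is "\<lambda>f g x. f x + g x"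
  by (auto simp: l2_rel_def intro: sq_int_add)

definition scaleR_L2 :: "real \<Rightarrow> 'a L2 \<Rightarrow> 'a L2" where
  "scaleR_L2 r v = complex_of_real r *\<^sub>C v"

definition uminus_L2 :: "'a L2 \<Rightarrow> 'a L2" where
  "uminus_L2 v = (-1) *\<^sub>C v"

definition minus_L2 :: "'a L2 \<Rightarrow> 'a L2 \<Rightarrow> 'a L2" where
  "minus_L2 v w = v + (-1) *\<^sub>C w"

instance
proof
  fix u v w :: "'a L2" and r s :: real
  show "u + v + w = u + (v + w)"
    by transfer (auto simp: l2_rel_def intro!: sq_int_add simp: add.assoc)
  show "u + v = v + u"
    by transfer (auto simp: l2_rel_def intro!: sq_int_add simp: add.commute)
  show "0 + u = u"
    by transfer (auto simp: l2_rel_def)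
  show "- u + u = 0"
    unfolding uminus_L2_def
    by transfer (auto simp: l2_rel_def sq_int_zero)
  show "u - v = u + - v"
    by (simp add: uminus_L2_def minus_L2_def)
  show "r *\<^sub>R (u + v) = r *\<^sub>R u + r *\<^sub>R v"
    unfolding scaleR_L2_def
    by transfer (auto simp: l2_rel_def distrib_left intro!: sq_int_add sq_int_cmult)
  show "(r + s) *\<^sub>R u = r *\<^sub>R u + s *\<^sub>R u"
    unfolding scaleR_L2_def
    by transfer (auto simp: l2_rel_def distrib_right intro!: sq_int_add sq_int_cmult)
  show "r *\<^sub>R s *\<^sub>R u = (r * s) *\<^sub>R u"
    unfolding scaleR_L2_def
    by transfer (auto simp: l2_rel_def mult.assoc intro!: sq_int_cmult)
  show "1 *\<^sub>R u = u"
    unfolding scaleR_L2_def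
    by transfer (auto simp: l2_rel_def)
qed

end

lemma cinner_commute: "cinner v w = cnj (cinner w v)"
  by transfer (simp flip: Bochner_Integration.integral_cnj add: mult.commute)

lemma cinner_add_left: "cinner (u + v) w = cinner u w + cinner v w"
  by transfer (simp add: distrib_right integrable_cnj_mult l2_rel_def)

lemma cinner_scaleC_left: "cinner (c *\<^sub>C v) w = cnj c * cinner v w"
  by transfer (simp add: mult.assoc)

lemma integral_cnj_self:
  "(\<integral>x. cnj (f x) * f x \<partial>M) = complex_of_real (\<integral>x. (cmod (f x))\<^sup>2 \<partial>M)"
proof -
  have "cnj (f x) * f x = complex_of_real ((cmod (f x))\<^sup>2)" for x
    by (simp only: complex_norm_square mult.commute)
  then show ?thesis
    by (simp only: integral_complex_of_real)
qed

lemma cinner_self: "cinner v v = complex_of_real (Re (cinner v v)) \<and> 0 \<le> Re (cinner v v)"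
proof transfer
  fix f :: "'a \<Rightarrow> complex"
  assume "l2_rel f f"
  have "(\<integral>x. cnj (f x) * f x \<partial>lebesgue) = complex_of_real (\<integral>x. (cmod (f x))\<^sup>2 \<partial>lebesgue)"
    by (rule integral_cnj_self)
  then show "(\<integral>x. cnj (f x) * f x \<partial>lebesgue)
      = complex_of_real (Re (\<integral>x. cnj (f x) * f x \<partial>lebesgue))
    \<and> 0 \<le> Re (\<integral>x. cnj (f x) * f x \<partial>lebesgue)"
    by simp
qed

lemma cinner_eq_zero_iff: "cinner v v = 0 \<longleftrightarrow> v = 0"
proof transfer
  fix f :: "'a \<Rightarrow> complex"
  assume f: "l2_rel f f"
  then have sq: "sq_int f"
    by (simp add: l2_rel_def)
  have "(\<integral>x. cnj (f x) * f x \<partial>lebesgue) = complex_of_real (\<integral>x. (cmod (f x))\<^sup>2 \<partial>lebesgue)"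
    by (rule integral_cnj_self)
  then have "(\<integral>x. cnj (f x) * f x \<partial>lebesgue) = 0 \<longleftrightarrow> (\<integral>x. (cmod (f x))\<^sup>2 \<partial>lebesgue) = 0"
    by simp
  also have "\<dots> \<longleftrightarrow> (AE x in lebesgue. (cmod (f x))\<^sup>2 = 0)"
    by (rule integral_nonneg_eq_0_iff_AE) (simp_all add: sq_int_integrable[OF sq])
  also have "\<dots> \<longleftrightarrow> l2_rel f (\<lambda>x. 0)"
    using sq by (simp add: l2_rel_def sq_int_zero)
  finally show "(\<integral>x. cnj (f x) * f x \<partial>lebesgue) = 0 \<longleftrightarrow> l2_rel f (\<lambda>x. 0)" .
qed

text \<open>
  The real part of the complex inner product makes the space a real inner product space with
  the same norm, so that norm, topology and \<open>bounded_linear\<close> are those of the library.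
\<close>

instantiation L2 :: (euclidean_space) real_inner
begin

definition inner_L2 :: "'a L2 \<Rightarrow> 'a L2 \<Rightarrow> real" where
  "inner_L2 v w = Re (cinner v w)"

definition norm_L2 :: "'a L2 \<Rightarrow> real" where
  "norm_L2 v = sqrt (Re (cinner v v))"

definition dist_L2 :: "'a L2 \<Rightarrow> 'a L2 \<Rightarrow> real" where
  "dist_L2 v w = norm (v - w)"

definition sgn_L2 :: "'a L2 \<Rightarrow> 'a L2" where
  "sgn_L2 v = inverse (norm v) *\<^sub>R v"

definition uniformity_L2 :: "('a L2 \<times> 'a L2) filter" where
  "uniformity_L2 = (INF e\<in>{0 <..}. principal {(v, w). dist v w < e})"

definition open_L2 :: "'a L2 set \<Rightarrow> bool" where
  "open_L2 U \<longleftrightarrow> (\<forall>v\<in>U. eventually (\<lambda>(v', w). v' = v \<longrightarrow> w \<in> U) uniformity)"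

instance
proof
  fix u v w :: "'a L2" and r :: real
  show "dist v w = norm (v - w)"
    by (rule dist_L2_def)
  show "sgn v = v /\<^sub>R norm v"
    by (rule sgn_L2_def)
  show "(uniformity :: ('a L2 \<times> 'a L2) filter) = (INF e\<in>{0 <..}. principal {(v, w). dist v w < e})"
    by (rule uniformity_L2_def)
  show "open U \<longleftrightarrow> (\<forall>v\<in>U. \<forall>\<^sub>F (v', w) in uniformity. v' = v \<longrightarrow> w \<in> U)" for U :: "'a L2 set"
    by (rule open_L2_def)
  show "inner v w = inner w v"
    unfolding inner_L2_def using cinner_commute[of v w] by simp
  show "inner (u + v) w = inner u w + inner v w"
    by (simp add: inner_L2_def cinner_add_left)
  show "inner (r *\<^sub>R v) w = r * inner v w"
    by (simp add: inner_L2_def scaleR_L2_def cinner_scaleC_left)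
  show "0 \<le> inner v v"
    using cinner_self[of v] by (simp add: inner_L2_def)
  show "inner v v = 0 \<longleftrightarrow> v = 0"
    using cinner_self[of v] cinner_eq_zero_iff[of v] by (auto simp: inner_L2_def complex_eq_iff)
  show "norm v = sqrt (inner v v)"
    by (simp add: inner_L2_def norm_L2_def)
qed

end

definition bounded_clinear :: "('a::euclidean_space L2 \<Rightarrow> 'a L2) \<Rightarrow> bool" where
  "bounded_clinear A \<longleftrightarrow> bounded_linear A \<and> (\<forall>c v. A (c *\<^sub>C v) = c *\<^sub>C A v)"

definition pure_state :: "'a::euclidean_space L2 \<Rightarrow> 'a L2 \<Rightarrow> 'a L2" where
  "pure_state u = (\<lambda>v. cinner u v *\<^sub>C u)"

definition orthonormal_basis :: "'a::euclidean_space L2 set \<Rightarrow> bool" where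
  "orthonormal_basis B \<longleftrightarrow>
     (\<forall>e\<in>B. \<forall>f\<in>B. cinner e f = (if e = f then 1 else 0)) \<and>
     (\<forall>v. (\<forall>e\<in>B. cinner e v = 0) \<longrightarrow> v = 0)"

text \<open>
  The trace of a trace-class operator: the common value of the (unconditionally convergent)
  sums of diagonal entries over all orthonormal bases. It is unspecified for other operators.
\<close>

definition trace_op :: "('a::euclidean_space L2 \<Rightarrow> 'a L2) \<Rightarrow> complex" where
  "trace_op T = (THE t. \<forall>B. orthonormal_basis B \<longrightarrow> ((\<lambda>e. cinner e (T e)) has_sum t) B)"

text \<open>
  Convergence in \<open>L\<^sub>1(M)\<close> of the random variables \<open>tr(R\<^sub>n A)\<close> includes that they are integrable
  (hence measurable); the Bochner integral of a non-integrable function would be \<open>0\<close>.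
\<close>

definition tendsto_state_wot_L1 ::
  "'w measure \<Rightarrow> (nat \<Rightarrow> 'w \<Rightarrow> 'a::euclidean_space L2 \<Rightarrow> 'a L2) \<Rightarrow> ('a L2 \<Rightarrow> 'a L2) \<Rightarrow> bool" where
  "tendsto_state_wot_L1 M R \<rho> \<longleftrightarrow>
     (\<forall>A. bounded_clinear A \<longrightarrow>
        (\<forall>n. integrable M (\<lambda>\<omega>. trace_op (R n \<omega> \<circ> A))) \<and>
        (\<lambda>n. \<integral>\<omega>. cmod (trace_op (R n \<omega> \<circ> A) - trace_op (\<rho> \<circ> A)) \<partial>M) \<longlonglongrightarrow> 0)"

text \<open>\<open>shift_prod a n u\<close> is \<open>S\<^bsub>a 1\<^esub> (S\<^bsub>a 2\<^esub> (\<dots> (S\<^bsub>a n\<^esub> u)))\<close>.\<close>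

definition shift_prod :: "(nat \<Rightarrow> 'a::euclidean_space) \<Rightarrow> nat \<Rightarrow> 'a L2 \<Rightarrow> 'a L2" where
  "shift_prod a n u = foldr (\<lambda>k. shift_op (a k)) [1..<Suc n] u"

end

theory Submission
  imports Defs
begin

text \<open>
  The trace of \<open>|u\<rangle>\<langle>u| A\<close> is \<open>\<langle>u, A u\<rangle>\<close>, and the product of the shifts is a single shift by the
  average \<open>(\<xi>\<^sub>1 + \<dots> + \<xi>\<^sub>n) / n\<close>. Hence the random variables in question are \<open>\<phi>\<close> of the average,
  where \<open>\<phi> a = \<langle>S\<^sub>a u, A S\<^sub>a u\<rangle>\<close> is bounded, and continuous since shifts are strongly continuous.
  By continuity at \<open>\<mu>\<close> there is \<open>C\<close> for each \<open>\<epsilon>\<close> with \<open>|\<phi> x - \<phi> \<mu>| \<le> \<epsilon> + C |x - \<mu>|\<close> for all \<open>x\<close>, so the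
  weak law of large numbers in \<open>L\<^sub>1\<close> gives the claim.
\<close>

subsection \<open>Completeness\<close>

text \<open>The trace is a \<open>THE\<close> over all orthonormal bases, so its value on
  \<open>pure_state u \<circ> A\<close> has to be forced from two sides: every basis must give the
  sum \<open>cinner u (A u)\<close>, and some basis must exist, since otherwise every number would
  satisfy the condition. The former rests on the expansion of \<open>u\<close> in an arbitrary
  basis, and the convergence of that expansion is where completeness enters. Bases are not presumed
  countable, so all these sums are unordered. Strong continuity starts from indicators of open sets,
  where topology gives pointwise convergence, and spreads by linearity and closedness to all
  vectors. Only a first moment is assumed, so Chebyshev's inequality cannot be applied to the
  \<xi>_k themselves; this is why the law of large numbers goes through truncation. The linear bound
  away from \<mu> comes from boundedness of \<phi>: at distance at least \<delta> from \<mu> the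
  difference is at most 2 sup|\<phi>|, hence at most (2 sup|\<phi>| / \<delta>) |x - \<mu>|.\<close>

lemma L2_exhaust:
  obtains f where "sq_int f" "v = abs_L2 f"
proof
  show "sq_int (rep_L2 v)"
    using Quotient3_rep_reflp[OF Quotient3_L2, of v] by (simp add: l2_rel_def)
  show "v = abs_L2 (rep_L2 v)"
    by (simp add: Quotient3_abs_rep[OF Quotient3_L2])
qed

lemma l2_rel_refl: "sq_int f \<Longrightarrow> l2_rel f f"
  by (simp add: l2_rel_def)

lemmas abs_L2_simps =
  cinner.abs_eq[OF l2_rel_refl l2_rel_refl] scaleC.abs_eq[OF l2_rel_refl]
  shift_op.abs_eq[OF l2_rel_refl] plus_L2.abs_eq[OF l2_rel_refl l2_rel_refl]

lemma sq_int_diff: "sq_int f \<Longrightarrow> sq_int g \<Longrightarrow> sq_int (\<lambda>x. f x - g x)"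
  using sq_int_add[of f "\<lambda>x. (-1) * g x"] sq_int_cmult[of g "-1"] by simp

lemma diff_abs_L2:
  assumes "sq_int f" "sq_int g"
  shows "abs_L2 f - abs_L2 g = abs_L2 (\<lambda>x. f x - g x)"
  using assms sq_int_cmult[of g "-1"] by (simp add: minus_L2_def abs_L2_simps)

lemma norm_L2_sq: "(norm v)\<^sup>2 = Re (cinner v v)"
  using cinner_self[of v] by (simp add: norm_L2_def)

lemma norm_abs_L2_sq:
  assumes "sq_int f"
  shows "(norm (abs_L2 f))\<^sup>2 = (\<integral>x. (cmod (f x))\<^sup>2 \<partial>lebesgue)"
  using assms by (simp add: norm_L2_sq abs_L2_simps integral_cnj_self)

lemma nn_integral_abs_L2:
  assumes "sq_int f"
  shows "(\<integral>\<^sup>+x. ennreal ((cmod (f x))\<^sup>2) \<partial>lebesgue) = ennreal ((norm (abs_L2 f))\<^sup>2)"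
  unfolding norm_abs_L2_sq[OF assms]
  by (intro nn_integral_eq_integral sq_int_integrable assms) auto

text \<open>The terms of a convergent series tend to 0, so the increments are eventually at most
  \<open>(1 / 2) ^ n\<close> and telescoping against a geometric series applies. The hypothesis is
  phrased in \<open>ennreal\<close> because it will come from the finiteness of an integral, at
  almost every point.\<close>

lemma convergent_if_geometric_increments:
  fixes g :: "nat \<Rightarrow> complex"
  assumes "(\<Sum>n. ennreal (4 ^ n * (cmod (g (Suc n) - g n))\<^sup>2)) \<noteq> \<infinity>"
  shows "convergent g"
proof -
  have "summable (\<lambda>n. 4 ^ n * (cmod (g (Suc n) - g n))\<^sup>2)"
    by (rule summable_suminf_not_top) (use assms in auto)
  then have "(\<lambda>n. 4 ^ n * (cmod (g (Suc n) - g n))\<^sup>2) \<longlonglongrightarrow> 0"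
    by (rule summable_LIMSEQ_zero)
  then have "\<forall>\<^sub>F n in sequentially. 4 ^ n * (cmod (g (Suc n) - g n))\<^sup>2 < 1"
    by (rule order_tendstoD) simp
  then have "\<forall>\<^sub>F n in sequentially. cmod (g (Suc n) - g n) \<le> (1 / 2) ^ n"
  proof eventually_elim
    case (elim n)
    have "(4::real) ^ n = (2 ^ n)\<^sup>2"
      by (simp add: power2_eq_square flip: power_mult_distrib)
    with elim have "(2 ^ n * cmod (g (Suc n) - g n))\<^sup>2 \<le> 1\<^sup>2"
      by (simp add: power_mult_distrib)
    then have "2 ^ n * cmod (g (Suc n) - g n) \<le> 1"
      by (rule power2_le_imp_le) simp
    then show ?case
      by (simp add: field_simps)
  qed
  then have "summable (\<lambda>n. g (Suc n) - g n)"
    by (intro summable_comparison_test_ev[OF _ summable_geometric[of "1 / 2 :: real"]]) auto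
  then have "convergent (\<lambda>n. g 0 + (\<Sum>k<n. g (Suc k) - g k))"
    by (intro convergent_add convergent_const) (simp add: summable_iff_convergent)
  then show ?thesis
    by (simp add: sum_lessThan_telescope)
qed

lemma Cauchy_rapid_subsequence:
  fixes X :: "nat \<Rightarrow> 'a::metric_space"
  assumes "Cauchy X" and \<epsilon>: "\<And>n. 0 < \<epsilon> n"
  obtains r :: "nat \<Rightarrow> nat" where "strict_mono r" "\<And>n. dist (X (r (Suc n))) (X (r n)) < \<epsilon> n"
proof -
  have "\<exists>N. \<forall>i\<ge>N. \<forall>j\<ge>N. dist (X i) (X j) < \<epsilon> n" for n
    using metric_CauchyD[OF assms(1) \<epsilon>[of n]] by blast
  then obtain N where N: "\<And>n i j. N n \<le> i \<Longrightarrow> N n \<le> j \<Longrightarrow> dist (X i) (X j) < \<epsilon> n"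
    by metis
  \<comment> \<open>Adding up all thresholds so far keeps \<open>r n\<close> above
    \<open>N n\<close>; the extra summand \<open>n\<close> makes \<open>r\<close> strictly
    increasing.\<close>
  define r where "r n = n + (\<Sum>k\<le>n. N k)" for n
  have "N n \<le> (\<Sum>k\<le>n. N k)" for n
    by (rule member_le_sum) auto
  then have "N n \<le> r n" "N n \<le> r (Suc n)" "r n < r (Suc n)" for n
    by (simp_all add: r_def trans_le_add1 trans_le_add2 le_SucI)
  then show thesis
    by (intro that[of r] N) (auto simp: strict_mono_Suc_iff)
qed

text \<open>Riesz-Fischer: a rapidly Cauchy subsequence converges almost everywhere, Fatou's lemma
  turns the pointwise limit into a limit in norm, and a Cauchy sequence with a convergent
  subsequence converges.\<close>

instance L2 :: (euclidean_space) complete_space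
proof
  fix X :: "nat \<Rightarrow> 'a L2"
  assume X: "Cauchy X"
  \<comment> \<open>The rate is chosen for the weight \<open>4 ^ n\<close> above: squared increments
    are below \<open>(1 / 16) ^ n\<close>, so the weighted ones stay below the summable
    \<open>(1 / 4) ^ n\<close>.\<close>
  obtain r :: "nat \<Rightarrow> nat" where r: "strict_mono r"
    and fast: "\<And>n. dist (X (r (Suc n))) (X (r n)) < (1 / 4) ^ n"
    by (rule Cauchy_rapid_subsequence[OF X, of "\<lambda>n. (1 / 4) ^ n"]) auto
  have "\<exists>f. sq_int f \<and> X (r n) = abs_L2 f" for n
    by (metis L2_exhaust)
  then obtain g where g: "\<And>n. sq_int (g n)" and Xg: "\<And>n. X (r n) = abs_L2 (g n)"
    by metis
  note [measurable] = sq_int_measurable[OF g]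
  have diff: "(\<integral>\<^sup>+x. ennreal ((cmod (g m x - g n x))\<^sup>2) \<partial>lebesgue)
      = ennreal ((dist (X (r m)) (X (r n)))\<^sup>2)" for m n
    by (simp add: nn_integral_abs_L2 sq_int_diff g Xg dist_norm diff_abs_L2)
  have "(\<integral>\<^sup>+x. (\<Sum>n. ennreal (4 ^ n * (cmod (g (Suc n) x - g n x))\<^sup>2)) \<partial>lebesgue)
      = (\<Sum>n. \<integral>\<^sup>+x. ennreal (4 ^ n * (cmod (g (Suc n) x - g n x))\<^sup>2) \<partial>lebesgue)"
    by (rule nn_integral_suminf) measurable
  also have "\<dots> = (\<Sum>n. ennreal (4 ^ n * (dist (X (r (Suc n))) (X (r n)))\<^sup>2))"
    by (simp add: ennreal_mult nn_integral_cmult diff)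
  also have "\<dots> \<le> (\<Sum>n. ennreal ((1 / 4) ^ n))"
  proof (intro suminf_le ennreal_leI)
    fix n
    have "4 ^ n * (dist (X (r (Suc n))) (X (r n)))\<^sup>2 \<le> 4 ^ n * ((1 / 4) ^ n)\<^sup>2"
      using fast[of n] by (intro mult_left_mono power_mono) auto
    also have "\<dots> = (1 / 4 :: real) ^ n"
      by (simp add: power2_eq_square field_simps)
    finally show "4 ^ n * (dist (X (r (Suc n))) (X (r n)))\<^sup>2 \<le> (1 / 4) ^ n" .
  qed auto
  also have "\<dots> = ennreal (\<Sum>n. (1 / 4) ^ n)"
    by (rule suminf_ennreal2) (auto intro: summable_geometric)
  finally have "(\<integral>\<^sup>+x. (\<Sum>n. ennreal (4 ^ n * (cmod (g (Suc n) x - g n x))\<^sup>2)) \<partial>lebesgue) \<noteq> \<infinity>"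
    by (auto simp: top_unique)
  then have "AE x in lebesgue. (\<Sum>n. ennreal (4 ^ n * (cmod (g (Suc n) x - g n x))\<^sup>2)) \<noteq> \<infinity>"
    by (intro nn_integral_PInf_AE) measurable
  then have conv: "AE x in lebesgue. convergent (\<lambda>n. g n x)"
    by eventually_elim (rule convergent_if_geometric_increments)
  \<comment> \<open>Where the sequence diverges, \<open>lim\<close> has an unspecified value; by
    \<open>conv\<close> this happens only on a null set.\<close>
  define F where "F x = lim (\<lambda>n. g n x)" for x
  have [measurable]: "F \<in> borel_measurable lebesgue"
    unfolding F_def by (rule borel_measurable_lim_metric) measurable
  \<comment> \<open>With \<open>n\<close> fixed, the Cauchy bound between \<open>g m\<close> and
    \<open>g n\<close> survives the limit in \<open>m\<close>.\<close>
  have fatou: "(\<integral>\<^sup>+x. ennreal ((cmod (F x - g n x))\<^sup>2) \<partial>lebesgue) \<le> ennreal (e\<^sup>2)"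
    if "\<forall>\<^sub>F m in sequentially. dist (X (r m)) (X (r n)) < e" for n e
  proof -
    have "AE x in lebesgue. ennreal ((cmod (F x - g n x))\<^sup>2)
        = liminf (\<lambda>m. ennreal ((cmod (g m x - g n x))\<^sup>2))"
      using conv
    proof eventually_elim
      case (elim x)
      then have "(\<lambda>m. g m x) \<longlonglongrightarrow> F x"
        by (simp add: F_def convergent_LIMSEQ_iff)
      then have "(\<lambda>m. ennreal ((cmod (g m x - g n x))\<^sup>2)) \<longlonglongrightarrow> ennreal ((cmod (F x - g n x))\<^sup>2)"
        by (intro tendsto_intros)
      then show ?case
        by (rule lim_imp_Liminf[OF sequentially_bot, symmetric])
    qed
    then have "(\<integral>\<^sup>+x. ennreal ((cmod (F x - g n x))\<^sup>2) \<partial>lebesgue)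
        = (\<integral>\<^sup>+x. liminf (\<lambda>m. ennreal ((cmod (g m x - g n x))\<^sup>2)) \<partial>lebesgue)"
      by (rule nn_integral_cong_AE)
    also have "\<dots> \<le> liminf (\<lambda>m. \<integral>\<^sup>+x. ennreal ((cmod (g m x - g n x))\<^sup>2) \<partial>lebesgue)"
      by (rule nn_integral_liminf) measurable
    also have "\<dots> \<le> ennreal (e\<^sup>2)"
      unfolding diff using that
      by (intro Liminf_le) (auto elim!: eventually_mono intro!: ennreal_leI power_mono)
    finally show ?thesis .
  qed
  have close: "\<forall>\<^sub>F n in sequentially. \<forall>\<^sub>F m in sequentially. dist (X (r m)) (X (r n)) < e"
    if "e > 0" for e
  proof -
    from metric_CauchyD[OF Cauchy_subseq_Cauchy[OF X r] that]
    obtain K where "\<And>m n. m \<ge> K \<Longrightarrow> n \<ge> K \<Longrightarrow> dist (X (r m)) (X (r n)) < e"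
      by (auto simp: o_def)
    then show ?thesis
      unfolding eventually_sequentially by blast
  qed
  have Fg: "sq_int (\<lambda>x. F x - g n x)"
    if "\<forall>\<^sub>F m in sequentially. dist (X (r m)) (X (r n)) < e" for n e
    using le_less_trans[OF fatou[OF that] ennreal_less_top]
    by (auto simp: sq_int_def integrable_iff_bounded)
  \<comment> \<open>\<open>F\<close> is the sum of \<open>F - g n\<close> and \<open>g n\<close>; a
    single \<open>n\<close> with a finite bound is enough.\<close>
  have F: "sq_int F"
  proof -
    obtain n where "\<forall>\<^sub>F m in sequentially. dist (X (r m)) (X (r n)) < 1"
      using eventually_happens[OF close[of 1]] by auto
    from sq_int_add[OF Fg[OF this] g[of n]] show ?thesis
      by simp
  qed
  have "(\<lambda>n. X (r n)) \<longlonglongrightarrow> abs_L2 F"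
  proof (rule tendstoI)
    fix e :: real assume e: "e > 0"
    then have "\<forall>\<^sub>F n in sequentially. \<forall>\<^sub>F m in sequentially. dist (X (r m)) (X (r n)) < e / 2"
      by (intro close) simp
    then show "\<forall>\<^sub>F n in sequentially. dist (X (r n)) (abs_L2 F) < e"
    proof eventually_elim
      case (elim n)
      have "ennreal ((dist (X (r n)) (abs_L2 F))\<^sup>2) \<le> ennreal ((e / 2)\<^sup>2)"
        using fatou[OF elim]
        by (simp add: nn_integral_abs_L2 sq_int_diff g F Xg dist_commute[of _ "abs_L2 F"]
            dist_norm[of "abs_L2 F"] diff_abs_L2)
      then have "dist (X (r n)) (abs_L2 F) \<le> e / 2"
        using e by (auto simp: ennreal_le_iff intro: power2_le_imp_le)
      with e show ?case by simp
    qed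
  qed
  then show "convergent X"
    using Cauchy_converges_subseq[OF X r] by (auto simp: o_def convergent_def)
qed

subsection \<open>The complex inner product\<close>

lemma cinner_scaleC_right: "cinner v (c *\<^sub>C w) = c * cinner v w"
  using cinner_scaleC_left[of c w v] cinner_commute[of v] by (metis complex_cnj_cnj complex_cnj_mult)

lemma scaleC_add_right: "c *\<^sub>C (v + w) = c *\<^sub>C v + c *\<^sub>C w"
  by transfer (auto simp: l2_rel_def distrib_left intro!: sq_int_add sq_int_cmult)

lemma scaleC_scaleC: "c *\<^sub>C d *\<^sub>C v = (c * d) *\<^sub>C v"
  by transfer (auto simp: l2_rel_def mult.assoc intro!: sq_int_cmult)

lemma norm_scaleC: "norm (c *\<^sub>C v) = cmod c * norm v"
proof (rule power2_eq_imp_eq)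
  have "cinner (c *\<^sub>C v) (c *\<^sub>C v) = complex_of_real ((cmod c)\<^sup>2) * cinner v v"
    unfolding cinner_scaleC_left cinner_scaleC_right complex_norm_square by (simp only: mult_ac)
  then show "(norm (c *\<^sub>C v))\<^sup>2 = (cmod c * norm v)\<^sup>2"
    unfolding norm_L2_sq power_mult_distrib by (simp del: of_real_power)
qed auto

lemma bounded_linear_scaleC: "bounded_linear ((*\<^sub>C) c)"
  by (rule bounded_linear_intro[where K = "cmod c"])
    (auto simp: scaleC_add_right scaleR_L2_def scaleC_scaleC norm_scaleC mult.commute)

text \<open>Multiplying the first argument by \<open>\<i>\<close> moves the imaginary part into the
  real part. Continuity and bounds for \<open>cinner\<close> thereby come from the real inner
  product of the library.\<close>

lemma cinner_eq_inner: "cinner v w = of_real (inner v w) + \<i> * of_real (inner (\<i> *\<^sub>C v) w)"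
  by (simp add: inner_L2_def cinner_scaleC_left complex_eq_iff)

lemma bounded_linear_cinner_right: "bounded_linear (cinner v)"
  unfolding cinner_eq_inner[abs_def]
  by (intro bounded_linear_add bounded_linear_compose[OF bounded_linear_mult_right]
      bounded_linear_compose[OF bounded_linear_of_real] bounded_linear_inner_right)

lemma continuous_on_cinner [continuous_intros]:
  assumes "continuous_on S f" "continuous_on S g"
  shows "continuous_on S (\<lambda>x. cinner (f x) (g x))"
  unfolding cinner_eq_inner
  by (intro continuous_intros assms bounded_linear.continuous_on[OF bounded_linear_scaleC])

text \<open>The factor 2 comes from applying the real Cauchy-Schwarz inequality to the real and the
  imaginary part separately.\<close>

lemma norm_cinner_le: "cmod (cinner u v) \<le> 2 * norm u * norm v"
proof -
  have "cmod (cinner u v) \<le> \<bar>inner u v\<bar> + \<bar>inner (\<i> *\<^sub>C u) v\<bar>"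
    using cmod_le[of "cinner u v"] by (simp add: cinner_eq_inner[of u v])
  also have "\<dots> \<le> norm u * norm v + norm (\<i> *\<^sub>C u) * norm v"
    by (intro add_mono Cauchy_Schwarz_ineq2)
  finally show ?thesis
    by (simp add: norm_scaleC)
qed

lemma cinner_sum_right: "cinner v (sum f F) = (\<Sum>e\<in>F. cinner v (f e))"
  by (rule linear_sum) (simp add: bounded_linear_cinner_right bounded_linear.linear)

lemma cinner_diff_right: "cinner v (u - w) = cinner v u - cinner v w"
  by (rule linear_diff[OF bounded_linear.linear[OF bounded_linear_cinner_right]])

subsection \<open>Orthonormal expansions and the trace\<close>

text \<open>This is the Cauchy criterion for unordered sums. Nested finite sets \<open>H n\<close>
  that contain the witnesses \<open>G n\<close> have Cauchy partial sums, and every finite superset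
  of \<open>H n\<close> has a partial sum close to theirs, so the limit along \<open>H\<close> is
  the limit along all finite sets.\<close>

lemma summable_on_if_small_tails:
  fixes f :: "'a \<Rightarrow> 'b::{real_normed_vector, complete_space}"
  assumes small: "\<And>e. e > 0 \<Longrightarrow>
      \<exists>G. finite G \<and> G \<subseteq> A \<and> (\<forall>F. finite F \<longrightarrow> F \<subseteq> A - G \<longrightarrow> norm (sum f F) < e)"
  shows "f summable_on A"
proof -
  have "\<exists>G. finite G \<and> G \<subseteq> A \<and> (\<forall>F. finite F \<longrightarrow> F \<subseteq> A - G \<longrightarrow> norm (sum f F) < 1 / Suc n)" for n
    by (rule small) simp
  then obtain G where G: "\<And>n. finite (G n)" "\<And>n. G n \<subseteq> A"
    and G_small: "\<And>n F. finite F \<Longrightarrow> F \<subseteq> A - G n \<Longrightarrow> norm (sum f F) < 1 / Suc n"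
    by metis
  define H where "H n = (\<Union>k\<le>n. G k)" for n
  have H: "finite (H n)" "H n \<subseteq> A" "G n \<subseteq> H n" for n
    using G by (auto simp: H_def)
  have H_close: "dist (sum f F) (sum f (H n)) < 1 / Suc n" if "finite F" "F \<subseteq> A" "H n \<subseteq> F" for n F
  proof -
    have "sum f F - sum f (H n) = sum f (F - H n)"
      using that by (simp add: sum_diff)
    moreover have "norm (sum f (F - H n)) < 1 / Suc n"
      using that H(3)[of n] by (intro G_small) auto
    ultimately show ?thesis
      by (simp add: dist_norm)
  qed
  have H_mono: "H m \<subseteq> H n" if "m \<le> n" for m n
    using that by (force simp: H_def)
  have "Cauchy (\<lambda>n. sum f (H n))"
  proof (rule metric_CauchyI)
    fix e :: real assume "e > 0"
    then obtain N where N: "1 / Suc N < e / 2"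
      using nat_approx_posE[of "e / 2"] by auto
    have "dist (sum f (H n)) (sum f (H N)) < e / 2" if "n \<ge> N" for n
      using H_close[OF H(1,2) H_mono[OF that]] N by simp
    then show "\<exists>N. \<forall>m\<ge>N. \<forall>n\<ge>N. dist (sum f (H m)) (sum f (H n)) < e"
      using dist_triangle_half_l by blast
  qed
  then obtain s where s: "(\<lambda>n. sum f (H n)) \<longlonglongrightarrow> s"
    using Cauchy_convergent convergent_def by blast
  have "(f has_sum s) A"
    unfolding has_sum_def
  proof (rule tendstoI)
    fix e :: real assume "e > 0"
    then have "\<forall>\<^sub>F n in sequentially. dist (sum f (H n)) s < e / 2"
      by (intro tendstoD[OF s]) simp
    moreover have "\<forall>\<^sub>F n in sequentially. 1 / real (Suc n) < e / 2"
      using \<open>e > 0\<close> by (intro order_tendstoD[OF LIMSEQ_Suc[OF lim_1_over_n]]) simp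
    ultimately have "\<forall>\<^sub>F n in sequentially. dist (sum f (H n)) s < e / 2 \<and> 1 / real (Suc n) < e / 2"
      by (rule eventually_conj)
    then obtain n where n: "dist (sum f (H n)) s < e / 2" "1 / real (Suc n) < e / 2"
      using eventually_happens'[OF sequentially_bot] by blast
    have "dist (sum f F) s < e" if "finite F" "F \<subseteq> A" "H n \<subseteq> F" for F
      using H_close[OF that] n dist_triangle[of "sum f F" s "sum f (H n)"] by linarith
    then show "\<forall>\<^sub>F F in finite_subsets_at_top A. dist (sum f F) s < e"
      unfolding eventually_finite_subsets_at_top using H(1,2) by (intro exI[of _ "H n"]) simp
  qed
  then show ?thesis
    by (auto simp: summable_on_def)
qed

text \<open>The first clause of \<open>orthonormal_basis\<close> on its own: Bessel's inequality
  uses just this, and Zorn's lemma is applied to it, with the second clause following from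
  maximality.\<close>

definition orthonormal :: "'a::euclidean_space L2 set \<Rightarrow> bool" where
  "orthonormal B \<longleftrightarrow> (\<forall>e\<in>B. \<forall>f\<in>B. cinner e f = (if e = f then 1 else 0))"

lemma cinner_fourier_sum:
  assumes "orthonormal B" "finite F" "F \<subseteq> B" "e \<in> B"
  shows "cinner e (\<Sum>f\<in>F. c f *\<^sub>C f) = (if e \<in> F then c e else 0)"
proof -
  have "cinner e (c f *\<^sub>C f) = (if e = f then c f else 0)" if "f \<in> F" for f
    using assms that by (auto simp: cinner_scaleC_right orthonormal_def subset_iff)
  then have "cinner e (\<Sum>f\<in>F. c f *\<^sub>C f) = (\<Sum>f\<in>F. if e = f then c f else 0)"
    by (simp only: cinner_sum_right cong: sum.cong)
  then show ?thesis
    using assms(2) by simp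
qed

lemma norm_fourier_sum_sq:
  assumes B: "orthonormal B" and F: "finite F" "F \<subseteq> B"
  shows "(norm (\<Sum>e\<in>F. c e *\<^sub>C e))\<^sup>2 = (\<Sum>e\<in>F. (cmod (c e))\<^sup>2)"
proof -
  let ?s = "\<Sum>e\<in>F. c e *\<^sub>C e"
  have "cinner ?s e = cnj (c e)" if "e \<in> F" for e
    using cinner_fourier_sum[OF B F, of e c] that F(2)
    by (subst cinner_commute) auto
  moreover have "cinner ?s ?s = (\<Sum>e\<in>F. c e * cinner ?s e)"
    by (simp only: cinner_sum_right[of ?s] cinner_scaleC_right)
  ultimately have "cinner ?s ?s = (\<Sum>e\<in>F. c e * cnj (c e))"
    by (simp only: cong: sum.cong)
  also have "\<dots> = of_real (\<Sum>e\<in>F. (cmod (c e))\<^sup>2)"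
    by (simp only: flip: complex_norm_square) simp
  finally show ?thesis
    by (simp add: norm_L2_sq)
qed

text \<open>The vector \<open>u\<close> minus its partial expansion is orthogonal to that expansion,
  so Pythagoras applies.\<close>

lemma bessel_inequality:
  assumes B: "orthonormal B" and F: "finite F" "F \<subseteq> B"
  shows "(\<Sum>e\<in>F. (cmod (cinner e u))\<^sup>2) \<le> (norm u)\<^sup>2"
proof -
  let ?s = "\<Sum>e\<in>F. cinner e u *\<^sub>C e"
  have "cinner e (u - ?s) = 0" if "e \<in> F" for e
    using cinner_fourier_sum[OF B F, of e "\<lambda>e. cinner e u"] that F(2) by (auto simp: cinner_diff_right)
  then have "cinner (u - ?s) e = 0" if "e \<in> F" for e
    using that by (subst cinner_commute) simp
  then have "cinner (u - ?s) ?s = 0"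
    by (simp add: cinner_sum_right cinner_scaleC_right)
  then have "inner (u - ?s) ?s = 0"
    by (simp add: inner_L2_def)
  then have "(norm u)\<^sup>2 = (norm (u - ?s))\<^sup>2 + (norm ?s)\<^sup>2"
    using norm_add_Pythagorean[of "u - ?s" ?s] by (simp add: orthogonal_def)
  then show ?thesis
    by (simp add: norm_fourier_sum_sq[OF B F])
qed

text \<open>Bessel's inequality makes the squared coefficients summable. The squared norm of a
  finite tail is the sum of its squared coefficients, so the Cauchy criterion yields a sum
  \<open>v\<close>. The vector \<open>u - v\<close> is orthogonal to the basis and therefore
  0.\<close>

lemma fourier_expansion:
  assumes B: "orthonormal_basis B"
  shows "((\<lambda>e. cinner e u *\<^sub>C e) has_sum u) B"
proof -
  have on: "orthonormal B" and total: "\<And>v. (\<And>e. e \<in> B \<Longrightarrow> cinner e v = 0) \<Longrightarrow> v = 0"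
    using B by (auto simp: orthonormal_basis_def orthonormal_def)
  have "(\<lambda>e. (cmod (cinner e u))\<^sup>2) summable_on B"
    by (rule nonneg_bdd_above_summable_on)
      (auto intro!: bdd_aboveI[where M = "(norm u)\<^sup>2"] bessel_inequality[OF on])
  then obtain S where S: "((\<lambda>e. (cmod (cinner e u))\<^sup>2) has_sum S) B"
    by (auto simp: summable_on_def)
  have "(\<lambda>e. cinner e u *\<^sub>C e) summable_on B"
  proof (rule summable_on_if_small_tails)
    fix e :: real assume e: "e > 0"
    \<comment> \<open>A tail is the difference of two partial sums, each within
      \<open>e\<^sup>2 / 2\<close> of \<open>S\<close>; its squared norm is then below
      \<open>e\<^sup>2\<close>.\<close>
    then have "\<forall>\<^sub>F F in finite_subsets_at_top B. dist (\<Sum>e\<in>F. (cmod (cinner e u))\<^sup>2) S < e\<^sup>2 / 2"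
      using S unfolding has_sum_def by (intro tendstoD) auto
    then obtain G where G: "finite G" "G \<subseteq> B"
      and close: "\<And>F. finite F \<Longrightarrow> G \<subseteq> F \<Longrightarrow> F \<subseteq> B \<Longrightarrow> dist (\<Sum>e\<in>F. (cmod (cinner e u))\<^sup>2) S < e\<^sup>2 / 2"
      by (auto simp: eventually_finite_subsets_at_top)
    have "norm (\<Sum>e\<in>F. cinner e u *\<^sub>C e) < e" if F: "finite F" "F \<subseteq> B - G" for F
    proof (rule power2_less_imp_less)
      have "(norm (\<Sum>e\<in>F. cinner e u *\<^sub>C e))\<^sup>2 = (\<Sum>e\<in>F. (cmod (cinner e u))\<^sup>2)"
        using F by (intro norm_fourier_sum_sq[OF on]) auto
      also have "\<dots> = (\<Sum>e\<in>G \<union> F. (cmod (cinner e u))\<^sup>2) - (\<Sum>e\<in>G. (cmod (cinner e u))\<^sup>2)"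
        using F G by (subst sum.union_disjoint) auto
      also have "\<dots> < e\<^sup>2"
      proof -
        have "G \<union> F \<subseteq> B"
          using F G by auto
        then have "\<bar>(\<Sum>e\<in>G \<union> F. (cmod (cinner e u))\<^sup>2) - S\<bar> < e\<^sup>2 / 2"
          using close[of "G \<union> F"] F G by (simp add: dist_real_def)
        moreover have "\<bar>(\<Sum>e\<in>G. (cmod (cinner e u))\<^sup>2) - S\<bar> < e\<^sup>2 / 2"
          using close[OF G(1) order_refl G(2)] by (simp add: dist_real_def)
        ultimately show ?thesis
          unfolding abs_less_iff by linarith
      qed
      finally show "(norm (\<Sum>e\<in>F. cinner e u *\<^sub>C e))\<^sup>2 < e\<^sup>2" .
    qed (use e in simp)
    with G show "\<exists>G. finite G \<and> G \<subseteq> B \<and>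
        (\<forall>F. finite F \<longrightarrow> F \<subseteq> B - G \<longrightarrow> norm (\<Sum>e\<in>F. cinner e u *\<^sub>C e) < e)"
      by blast
  qed
  then obtain v where v: "((\<lambda>e. cinner e u *\<^sub>C e) has_sum v) B"
    by (auto simp: summable_on_def)
  have "cinner e (u - v) = 0" if e: "e \<in> B" for e
  proof -
    have "((\<lambda>f. cinner e (cinner f u *\<^sub>C f)) has_sum cinner e v) B"
      by (rule has_sum_bounded_linear[OF bounded_linear_cinner_right v])
    \<comment> \<open>By orthonormality only the term with \<open>f = e\<close> is nonzero.\<close>
    moreover have "((\<lambda>f. cinner e (cinner f u *\<^sub>C f)) has_sum cinner e u) B"
      using e on by (intro has_sum_finite_neutralI[of "{e}"])
        (auto simp: cinner_scaleC_right orthonormal_def)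
    ultimately show ?thesis
      using has_sum_unique by (fastforce simp: cinner_diff_right)
  qed
  then show ?thesis
    using total[of "u - v"] v by simp
qed

text \<open>A maximal orthonormal set is total, because a nonzero vector orthogonal to it could be
  normalised and adjoined.\<close>

lemma orthonormal_basis_exists: "\<exists>B :: 'a::euclidean_space L2 set. orthonormal_basis B"
proof -
  have "\<exists>B\<in>Collect (orthonormal :: 'a L2 set \<Rightarrow> bool). \<forall>C\<in>Collect orthonormal. B \<subseteq> C \<longrightarrow> C = B"
  proof (rule subset_Zorn_nonempty)
    show "Collect (orthonormal :: 'a L2 set \<Rightarrow> bool) \<noteq> {}"
      using exI[of orthonormal "{}"] by (auto simp: orthonormal_def)
    fix \<C> :: "'a L2 set set"
    assume "subset.chain (Collect orthonormal) \<C>"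
    then have on: "\<And>C. C \<in> \<C> \<Longrightarrow> orthonormal C"
      and chain: "\<And>C D. C \<in> \<C> \<Longrightarrow> D \<in> \<C> \<Longrightarrow> C \<subseteq> D \<or> D \<subseteq> C"
      by (auto simp: subset.chain_def)
    have "cinner e f = (if e = f then 1 else 0)" if ef: "C \<in> \<C>" "D \<in> \<C>" "e \<in> C" "f \<in> D" for e f C D
    proof -
      obtain E where "E \<in> \<C>" "e \<in> E" "f \<in> E"
        using chain[OF ef(1,2)] ef by blast
      then show ?thesis
        using on[of E] by (simp add: orthonormal_def)
    qed
    then show "\<Union>\<C> \<in> Collect orthonormal"
      unfolding orthonormal_def by blast
  qed
  then obtain B :: "'a L2 set" where B: "orthonormal B"
    and maximal: "\<And>C. orthonormal C \<Longrightarrow> B \<subseteq> C \<Longrightarrow> C = B"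
    by blast
  have "v = 0" if v: "\<And>e. e \<in> B \<Longrightarrow> cinner e v = 0" for v
  proof (rule ccontr)
    assume "v \<noteq> 0"
    define w where "w = complex_of_real (1 / norm v) *\<^sub>C v"
    have "norm w = 1"
      using \<open>v \<noteq> 0\<close> by (simp add: w_def norm_scaleC norm_divide)
    then have ww: "cinner w w = 1"
      using norm_L2_sq[of w] cinner_self[of w] by simp
    have wB: "cinner e w = 0" "cinner w e = 0" if "e \<in> B" for e
      using v[OF that] cinner_commute[of v e] by (simp_all add: w_def cinner_scaleC_right cinner_scaleC_left)
    with ww have "w \<notin> B"
      by force
    with B ww wB have "orthonormal (insert w B)"
      by (auto simp: orthonormal_def)
    from maximal[OF this] \<open>w \<notin> B\<close> show False
      by blast
  qed
  then have "\<forall>v. (\<forall>e\<in>B. cinner e v = 0) \<longrightarrow> v = 0"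
    by blast
  with B show ?thesis
    unfolding orthonormal_basis_def orthonormal_def by (intro exI conjI)
qed

text \<open>The diagonal entry at \<open>e\<close> is \<open>cinner e u * cinner u (A e)\<close>.
  These are the terms obtained by applying the bounded functional
  \<open>\<lambda>v. cinner u (A v)\<close> to the expansion of \<open>u\<close>, so their sum is
  \<open>cinner u (A u)\<close> in every basis.\<close>

lemma trace_pure_state:
  assumes A: "bounded_clinear A"
  shows "trace_op (pure_state u \<circ> A) = cinner u (A u)"
  unfolding trace_op_def
proof (rule the_equality)
  show *: "\<forall>B. orthonormal_basis B \<longrightarrow>
      ((\<lambda>e. cinner e ((pure_state u \<circ> A) e)) has_sum cinner u (A u)) B"
  proof (intro allI impI)
    fix B :: "'a L2 set"
    assume B: "orthonormal_basis B"
    have "bounded_linear (\<lambda>v. cinner u (A v))"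
      using A by (intro bounded_linear_compose[OF bounded_linear_cinner_right[of u]])
        (simp add: bounded_clinear_def)
    from has_sum_bounded_linear[OF this fourier_expansion[OF B, of u]]
    show "((\<lambda>e. cinner e ((pure_state u \<circ> A) e)) has_sum cinner u (A u)) B"
      using A by (simp add: bounded_clinear_def pure_state_def cinner_scaleC_right mult.commute)
  qed
  fix t
  assume t: "\<forall>B. orthonormal_basis B \<longrightarrow> ((\<lambda>e. cinner e ((pure_state u \<circ> A) e)) has_sum t) B"
  obtain B :: "'a L2 set" where "orthonormal_basis B"
    using orthonormal_basis_exists by blast
  with * t show "t = cinner u (A u)"
    by (metis has_sum_unique)
qed

subsection \<open>Strong continuity of shifts\<close>

text \<open>Translation invariance of Lebesgue measure.\<close>

lemma cinner_shift_op: "cinner (shift_op a u) (shift_op a v) = cinner u v"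
proof -
  obtain f g where f: "sq_int f" "u = abs_L2 f" and g: "sq_int g" "v = abs_L2 g"
    by (metis L2_exhaust)
  have "(\<integral>x. cnj (f (x + a)) * g (x + a) \<partial>lebesgue)
      = (\<integral>x. cnj (f x) * g x \<partial>distr lebesgue lebesgue (\<lambda>x. x + a))"
    by (rule integral_distr[symmetric, OF lebesgue_measurable_shift])
      (rule borel_measurable_integrable[OF integrable_cnj_mult[OF f(1) g(1)]])
  then show ?thesis
    using f g by (simp add: abs_L2_simps sq_int_shift lebesgue_distr_shift)
qed

lemma norm_shift_op: "norm (shift_op a u) = norm u"
  by (simp add: norm_L2_def cinner_shift_op)

lemma shift_op_add: "shift_op a (u + v) = shift_op a u + shift_op a v"
  by transfer (auto simp: l2_rel_def intro!: sq_int_add sq_int_shift)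

lemma shift_op_scaleC: "shift_op a (c *\<^sub>C u) = c *\<^sub>C shift_op a u"
  by transfer (auto simp: l2_rel_def intro!: sq_int_cmult sq_int_shift)

lemma shift_op_diff: "shift_op a (u - v) = shift_op a u - shift_op a v"
  by (simp add: minus_L2_def shift_op_add shift_op_scaleC)

lemma shift_op_shift_op: "shift_op a (shift_op b u) = shift_op (a + b) u"
  by transfer (auto simp: l2_rel_def add.assoc intro!: sq_int_shift)

lemma shift_op_0: "shift_op 0 u = u"
  by transfer (auto simp: l2_rel_def)

lemma shift_prod_eq: "shift_prod a n u = shift_op (\<Sum>k=1..n. a k) u"
proof -
  have "foldr (\<lambda>k. shift_op (a k)) ks u = shift_op (sum_list (map a ks)) u" for ks :: "nat list"
    by (induction ks) (simp_all add: shift_op_0 shift_op_shift_op)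
  then show ?thesis
    by (simp add: shift_prod_def interv_sum_list_conv_sum_set_nat atLeastLessThanSuc_atLeastAtMost
        del: upt_Suc)
qed

text \<open>Since shifts are isometries, strong continuity at 0 reduces to convergence of the scalar
  correlation of \<open>u\<close> with its translate.\<close>

lemma norm_shift_op_diff_sq: "(norm (shift_op a u - u))\<^sup>2 = 2 * ((norm u)\<^sup>2 - Re (cinner (shift_op a u) u))"
proof -
  have "(norm (shift_op a u - u))\<^sup>2 = (norm (shift_op a u))\<^sup>2 + (norm u)\<^sup>2 - 2 * inner (shift_op a u) u"
    by (simp add: power2_norm_eq_inner inner_diff inner_commute)
  then show ?thesis
    by (simp add: norm_shift_op inner_L2_def)
qed

text \<open>The vectors with this property are closed under sums, complex multiples and limits, so
  it suffices to exhibit enough of them to be dense. Continuity at other points will follow from the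
  group law.\<close>

abbreviation shift_continuous :: "'a::euclidean_space L2 \<Rightarrow> bool" where
  "shift_continuous u \<equiv> (\<lambda>a. shift_op a u) \<midarrow>0\<rightarrow> u"

lemma shift_continuous_add: "shift_continuous u \<Longrightarrow> shift_continuous v \<Longrightarrow> shift_continuous (u + v)"
  by (simp add: shift_op_add tendsto_add)

lemma shift_continuous_scaleC: "shift_continuous u \<Longrightarrow> shift_continuous (c *\<^sub>C u)"
  by (simp add: shift_op_scaleC bounded_linear.tendsto[OF bounded_linear_scaleC])

text \<open>A three-epsilon argument: shifting preserves the distance from \<open>X n\<close> to
  \<open>u\<close>, so that error is uniform in the shift.\<close>

lemma shift_continuous_limit:
  assumes X: "\<And>n. shift_continuous (X n)" and lim: "X \<longlonglongrightarrow> u"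
  shows "shift_continuous u"
proof (rule tendstoI)
  fix e :: real assume "e > 0"
  then have "\<forall>\<^sub>F n in sequentially. dist (X n) u < e / 3"
    by (intro tendstoD[OF lim]) simp
  then obtain n where n: "dist (X n) u < e / 3"
    by (meson eventually_happens sequentially_bot)
  have "\<forall>\<^sub>F a in at 0. dist (shift_op a (X n)) (X n) < e / 3"
    using \<open>e > 0\<close> by (intro tendstoD[OF X]) simp
  then show "\<forall>\<^sub>F a in at 0. dist (shift_op a u) u < e"
  proof eventually_elim
    case (elim a)
    have "dist (shift_op a u) (shift_op a (X n)) = dist (X n) u"
      by (simp add: dist_norm norm_shift_op norm_minus_commute flip: shift_op_diff)
    then show ?case
      using n elim dist_triangle[of "shift_op a u" u "shift_op a (X n)"]
        dist_triangle[of "shift_op a (X n)" u "X n"] by linarith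
  qed
qed

lemma sq_int_indicator:
  assumes "E \<in> lmeasurable"
  shows "sq_int (indicator E :: _ \<Rightarrow> complex)"
proof -
  have "(\<lambda>x. (cmod (indicator E x))\<^sup>2) = indicat_real E"
    by (auto simp: indicator_def)
  then show ?thesis
    using assms fmeasurableD[OF assms] by (auto simp: sq_int_def lmeasurable_iff_integrable)
qed

text \<open>
  The indicator of an open set is lower semicontinuous, so its translates converge to 1
  pointwise on the set itself.
\<close>

lemma shift_continuous_indicator_open:
  fixes U :: "'a::euclidean_space set"
  assumes "open U" and U: "U \<in> lmeasurable"
  shows "shift_continuous (abs_L2 (indicator U))"
proof -
  let ?u = "abs_L2 (indicator U) :: 'a L2"
  \<comment> \<open>The limit is tested along sequences, the setting of dominated
    convergence.\<close>
  have "((\<lambda>a. shift_op a ?u) \<circ> a) \<longlonglongrightarrow> ?u" if a: "a \<longlonglongrightarrow> 0" for a :: "nat \<Rightarrow> 'a"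
  proof -
    have [measurable]: "(\<lambda>x. indicat_real U (x + a n)) \<in> borel_measurable lebesgue" for n
      by (rule measurable_compose[OF lebesgue_measurable_shift]) (use U in measurable)
    have [measurable]: "U \<in> sets lebesgue"
      using U by auto
    have cinner: "cinner (shift_op b ?u) ?u
        = complex_of_real (\<integral>x. indicat_real U (x + b) * indicat_real U x \<partial>lebesgue)" for b
    proof -
      have "cnj (indicator U (x + b)) * indicator U x
          = complex_of_real (indicat_real U (x + b) * indicat_real U x)" for x
        by (simp add: indicator_def)
      then show ?thesis
        using U by (simp add: abs_L2_simps sq_int_shift sq_int_indicator
            del: of_real_mult flip: integral_complex_of_real)
    qed
    have "(\<lambda>n. \<integral>x. indicat_real U (x + a n) * indicat_real U x \<partial>lebesgue)
        \<longlonglongrightarrow> (\<integral>x. indicat_real U x \<partial>lebesgue)"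
    proof (rule integral_dominated_convergence[where w = "indicat_real U"])
      show "integrable lebesgue (indicat_real U)"
        using U by (simp add: lmeasurable_iff_integrable)
      \<comment> \<open>Outside \<open>U\<close> the second factor makes both sides 0. Inside,
        openness keeps \<open>x + a n\<close> in \<open>U\<close> eventually.\<close>
      have "(\<lambda>n. indicat_real U (x + a n) * indicat_real U x) \<longlonglongrightarrow> indicat_real U x" for x
      proof (cases "x \<in> U")
        case True
        have "(\<lambda>n. x + a n) \<longlonglongrightarrow> x + 0"
          by (intro tendsto_intros a)
        then have "\<forall>\<^sub>F n in sequentially. x + a n \<in> U"
          using True \<open>open U\<close> by (intro topological_tendstoD) auto
        then have "\<forall>\<^sub>F n in sequentially. indicat_real U (x + a n) * indicat_real U x = indicat_real U x"
          by eventually_elim simp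
        then show ?thesis
          by (rule tendsto_eventually)
      qed simp
      then show "AE x in lebesgue. (\<lambda>n. indicat_real U (x + a n) * indicat_real U x) \<longlonglongrightarrow> indicat_real U x"
        by simp
      show "AE x in lebesgue. norm (indicat_real U (x + a n) * indicat_real U x) \<le> indicat_real U x" for n
        by (simp add: indicator_def)
    qed measurable
    moreover have "(\<integral>x. indicat_real U x \<partial>lebesgue) = (norm ?u)\<^sup>2"
      using cinner[of 0]
      by (simp add: shift_op_0 norm_L2_sq flip: indicator_inter_arith)
    ultimately have "(\<lambda>n. 2 * ((norm ?u)\<^sup>2 - Re (cinner (shift_op (a n) ?u) ?u)))
        \<longlonglongrightarrow> 2 * ((norm ?u)\<^sup>2 - (norm ?u)\<^sup>2)"
      unfolding cinner by (intro tendsto_intros) simp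
    then have "(\<lambda>n. (norm (shift_op (a n) ?u - ?u))\<^sup>2) \<longlonglongrightarrow> 0"
      by (simp add: norm_shift_op_diff_sq)
    then have "(\<lambda>n. norm (shift_op (a n) ?u - ?u)) \<longlonglongrightarrow> 0"
      using tendsto_real_sqrt by fastforce
    then show ?thesis
      by (simp add: o_def tendsto_norm_zero_iff LIM_zero_iff)
  qed
  then show ?thesis
    by (auto simp: tendsto_at_iff_sequentially)
qed

text \<open>Outer regularity encloses \<open>E\<close> in open sets with small excess, and the
  squared distance of the two indicators is the measure of that excess.\<close>

lemma shift_continuous_indicator:
  fixes E :: "'a::euclidean_space set"
  assumes E: "E \<in> lmeasurable"
  shows "shift_continuous (abs_L2 (indicator E))"
proof -
  have "\<exists>U. open U \<and> E \<subseteq> U \<and> U - E \<in> lmeasurable \<and> emeasure lebesgue (U - E) < ennreal (1 / Suc n)" for n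
    using sets_lebesgue_outer_open[of E "1 / Suc n"] E
    by (metis fmeasurableD of_nat_0_less_iff zero_less_Suc zero_less_divide_1_iff)
  then obtain U where U: "\<And>n. open (U n)" "\<And>n. E \<subseteq> U n" "\<And>n. U n - E \<in> lmeasurable"
    and small: "\<And>n. emeasure lebesgue (U n - E) < ennreal (1 / Suc n)"
    by metis
  have U_meas: "U n \<in> lmeasurable" for n
    using fmeasurable.Un[OF E U(3)[of n]] U(2)[of n] by (simp add: Un_absorb1)
  have dist: "(dist (abs_L2 (indicator (U n))) (abs_L2 (indicator E)))\<^sup>2 \<le> 1 / Suc n" for n
  proof -
    have eq: "indicator (U n) x - indicator E x = (indicator (U n - E) x :: complex)" for x
      using U(2)[of n] by (auto simp: indicator_def)
    have sq: "(\<lambda>x. (cmod (indicator (U n - E) x))\<^sup>2) = indicat_real (U n - E)"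
      by (auto simp: indicator_def)
    have "(dist (abs_L2 (indicator (U n))) (abs_L2 (indicator E)))\<^sup>2
        = (\<integral>x. indicat_real (U n - E) x \<partial>lebesgue)"
      using U_meas[of n] U(3)[of n] E
      by (simp add: dist_norm diff_abs_L2 sq_int_indicator eq sq norm_abs_L2_sq)
    also have "\<dots> = measure lebesgue (U n - E)"
      by simp
    also have "\<dots> \<le> 1 / Suc n"
      using small[of n] U(3)[of n] by (simp add: emeasure_eq_measure2 ennreal_less_iff)
    finally show ?thesis .
  qed
  have "(\<lambda>n. (dist (abs_L2 (indicator (U n))) (abs_L2 (indicator E)))\<^sup>2) \<longlonglongrightarrow> 0"
    by (rule tendsto_sandwich[OF always_eventually always_eventually tendsto_const
          LIMSEQ_Suc[OF lim_1_over_n]]) (intro allI zero_le_power2 dist)+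
  then have "(\<lambda>n. dist (abs_L2 (indicator (U n))) (abs_L2 (indicator E))) \<longlonglongrightarrow> 0"
    using tendsto_real_sqrt by fastforce
  then have "(\<lambda>n. abs_L2 (indicator (U n))) \<longlonglongrightarrow> abs_L2 (indicator E)"
    by (subst tendsto_dist_iff)
  with shift_continuous_indicator_open[OF U(1) U_meas] show ?thesis
    by (rule shift_continuous_limit)
qed

text \<open>A simple function is the finite sum of its values times the indicators of its level
  sets, so the indicator case and linearity apply once the level sets have finite measure.\<close>

lemma shift_continuous_simple:
  fixes f :: "'a::euclidean_space \<Rightarrow> complex"
  assumes f: "simple_function lebesgue f" and "sq_int f"
  shows "shift_continuous (abs_L2 f)"
proof -
  let ?s = "\<lambda>y x. y * indicator (f -` {y}) x"
  have "sq_int (?s y) \<and> shift_continuous (abs_L2 (?s y))" for y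
  \<comment> \<open>The level set of 0 may have infinite measure, but its summand vanishes. For
    \<open>y \<noteq> 0\<close>, square-integrability of \<open>f\<close> forces finite
    measure.\<close>
  proof (cases "y = 0")
    case True
    then show ?thesis
      by (simp add: sq_int_zero abs_L2_simps shift_op_0)
  next
    case False
    have E: "f -` {y} \<in> sets lebesgue"
      using simple_functionD(2)[OF f, of "{y}"] by simp
    have "integrable lebesgue (\<lambda>x. (cmod y)\<^sup>2 * indicat_real (f -` {y}) x)"
    proof (rule Bochner_Integration.integrable_bound[OF sq_int_integrable[OF \<open>sq_int f\<close>]])
      show "AE x in lebesgue. norm ((cmod y)\<^sup>2 * indicat_real (f -` {y}) x) \<le> norm ((cmod (f x))\<^sup>2)"
        by (auto simp: indicator_def)
    qed (use E in measurable)
    then have E': "f -` {y} \<in> lmeasurable"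
      using False by (simp add: lmeasurable_iff_integrable)
    then show ?thesis
      using shift_continuous_scaleC[OF shift_continuous_indicator[OF E'], of y]
      by (simp add: sq_int_cmult sq_int_indicator abs_L2_simps)
  qed
  note summand = this
  have "sq_int (\<lambda>x. \<Sum>y\<in>Y. ?s y x) \<and> shift_continuous (abs_L2 (\<lambda>x. \<Sum>y\<in>Y. ?s y x))"
    if "finite Y" for Y
    using that
  proof induction
    case empty
    show ?case
      using summand[of 0] by simp
  next
    case (insert y Y)
    let ?S = "\<lambda>x. \<Sum>y\<in>Y. ?s y x"
    have "shift_continuous (abs_L2 (?s y) + abs_L2 ?S)"
      using summand[of y] insert.IH by (intro shift_continuous_add) simp_all
    moreover have "abs_L2 (?s y) + abs_L2 ?S = abs_L2 (\<lambda>x. ?s y x + ?S x)"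
      using summand[of y] insert.IH by (intro plus_L2.abs_eq l2_rel_refl) simp_all
    ultimately have "shift_continuous (abs_L2 (\<lambda>x. ?s y x + ?S x))"
      by (simp only:)
    then show ?case
      using summand[of y] insert.IH unfolding sum.insert[OF insert.hyps]
      by (intro conjI sq_int_add) simp_all
  qed
  note partial_sum = this
  have "finite (range f)"
    using simple_functionD(1)[OF f] by simp
  moreover from this have "(\<lambda>x. \<Sum>y\<in>range f. ?s y x) = f"
    by (auto simp: indicator_def if_distrib cong: if_cong)
  ultimately show ?thesis
    using partial_sum[of "range f"] by simp
qed

lemma shift_op_tendsto_0: "shift_continuous u"
proof -
  obtain f where f: "sq_int f" and u: "u = abs_L2 f"
    by (rule L2_exhaust)
  note [measurable] = sq_int_measurable[OF f]
  obtain s where s: "\<And>n. simple_function lebesgue (s n)" and lim: "\<And>x. (\<lambda>n. s n x) \<longlonglongrightarrow> f x"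
    and bound: "\<And>n x. cmod (s n x) \<le> 2 * cmod (f x)"
    using borel_measurable_implies_sequence_metric[OF sq_int_measurable[OF f], of 0] by auto
  have [measurable]: "s n \<in> borel_measurable lebesgue" for n
    by (rule borel_measurable_simple_function[OF s])
  \<comment> \<open>The bound \<open>2 * cmod (f x)\<close> on the approximants gives
    \<open>cmod (s n x - f x) \<le> 3 * cmod (f x)\<close>, whence the constant 9 after
    squaring.\<close>
  have dom: "integrable lebesgue (\<lambda>x. 9 * (cmod (f x))\<^sup>2)"
    using sq_int_integrable[OF f] by simp
  have sq_s: "sq_int (s n)" for n
  proof -
    have "(cmod (s n x))\<^sup>2 \<le> 9 * (cmod (f x))\<^sup>2" for x
    proof -
      have "(cmod (s n x))\<^sup>2 \<le> 4 * (cmod (f x))\<^sup>2"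
        using power_mono[OF bound[of n x], of 2] by (simp add: power_mult_distrib)
      also have "\<dots> \<le> 9 * (cmod (f x))\<^sup>2"
        by (intro mult_right_mono) auto
      finally show ?thesis .
    qed
    then show ?thesis
      unfolding sq_int_def by (auto intro!: Bochner_Integration.integrable_bound[OF dom])
  qed
  have "(\<lambda>n. \<integral>x. (cmod (s n x - f x))\<^sup>2 \<partial>lebesgue) \<longlonglongrightarrow> (\<integral>x. 0 \<partial>(lebesgue :: 'a measure))"
  proof (rule integral_dominated_convergence[OF _ _ dom])
    have "(\<lambda>n. (cmod (s n x - f x))\<^sup>2) \<longlonglongrightarrow> (cmod (f x - f x))\<^sup>2" for x
      by (intro tendsto_intros lim)
    then show "AE x in lebesgue. (\<lambda>n. (cmod (s n x - f x))\<^sup>2) \<longlonglongrightarrow> 0"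
      by simp
    have "(cmod (s n x - f x))\<^sup>2 \<le> (3 * cmod (f x))\<^sup>2" for n x
      using norm_triangle_ineq4[of "s n x" "f x"] bound[of n x] by (intro power_mono) auto
    then show "AE x in lebesgue. norm ((cmod (s n x - f x))\<^sup>2) \<le> 9 * (cmod (f x))\<^sup>2" for n
      by (simp add: power_mult_distrib)
  qed measurable
  then have "(\<lambda>n. (dist (abs_L2 (s n)) u)\<^sup>2) \<longlonglongrightarrow> 0"
    by (simp add: u dist_norm diff_abs_L2 sq_s f sq_int_diff norm_abs_L2_sq)
  then have "(\<lambda>n. dist (abs_L2 (s n)) u) \<longlonglongrightarrow> 0"
    using tendsto_real_sqrt by fastforce
  then have "(\<lambda>n. abs_L2 (s n)) \<longlonglongrightarrow> u"
    by (subst tendsto_dist_iff)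
  with shift_continuous_simple[OF s sq_s] show ?thesis
    by (rule shift_continuous_limit)
qed

text \<open>By the group law, continuity at \<open>b\<close> for \<open>u\<close> is continuity at 0
  for the vector \<open>shift_op b u\<close>.\<close>

lemma continuous_on_shift_op: "continuous_on S (\<lambda>a. shift_op a u)"
proof -
  have "(\<lambda>a. shift_op a u) \<midarrow>b\<rightarrow> shift_op b u" for b
    using shift_op_tendsto_0[of "shift_op b u"]
    by (subst LIM_offset_zero_iff) (simp_all add: shift_op_shift_op add.commute)
  then show ?thesis
    by (simp add: continuous_at_imp_continuous_on isCont_def)
qed

subsection \<open>The weak law of large numbers\<close>

text \<open>This is nonnegativity of the variance of \<open>\<bar>X\<bar>\<close>.\<close>

lemma (in prob_space) expectation_abs_le_sqrt:
  fixes X :: "'a \<Rightarrow> real"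
  assumes X: "integrable M X" and X2: "integrable M (\<lambda>\<omega>. (X \<omega>)\<^sup>2)"
  shows "expectation (\<lambda>\<omega>. \<bar>X \<omega>\<bar>) \<le> sqrt (expectation (\<lambda>\<omega>. (X \<omega>)\<^sup>2))"
proof (rule real_le_rsqrt)
  have "0 \<le> variance (\<lambda>\<omega>. \<bar>X \<omega>\<bar>)"
    by (rule variance_positive)
  also have "\<dots> = expectation (\<lambda>\<omega>. \<bar>X \<omega>\<bar>\<^sup>2) - (expectation (\<lambda>\<omega>. \<bar>X \<omega>\<bar>))\<^sup>2"
    using X X2 by (intro variance_eq) auto
  finally show "(expectation (\<lambda>\<omega>. \<bar>X \<omega>\<bar>))\<^sup>2 \<le> expectation (\<lambda>\<omega>. (X \<omega>)\<^sup>2)"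
    by simp
qed

lemma (in prob_space) expectation_mult_indep_vars:
  fixes X :: "'i \<Rightarrow> 'a \<Rightarrow> real"
  assumes indep: "indep_vars (\<lambda>_. borel) X I" and int: "\<And>i. i \<in> I \<Longrightarrow> integrable M (X i)"
    and ij: "i \<in> I" "j \<in> I" "i \<noteq> j"
  shows "expectation (\<lambda>\<omega>. X i \<omega> * X j \<omega>) = expectation (X i) * expectation (X j)"
proof -
  have "indep_vars (\<lambda>_. borel) X {i, j}"
    by (rule indep_vars_subset[OF indep]) (use ij in auto)
  from indep_vars_lebesgue_integral[OF _ this] show ?thesis
    using int ij by auto
qed

text \<open>Independence and centering remove all cross terms, so the second moment grows linearly,
  not quadratically, in the number of summands.\<close>

lemma (in prob_space) expectation_sum_sq_indep_centered:
  fixes X :: "'i \<Rightarrow> 'a \<Rightarrow> real" and c :: real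
  assumes indep: "indep_vars (\<lambda>_. borel) X I" and I: "finite I"
    and bounded: "\<And>i \<omega>. i \<in> I \<Longrightarrow> \<bar>X i \<omega>\<bar> \<le> c" and centered: "\<And>i. i \<in> I \<Longrightarrow> expectation (X i) = 0"
  shows "expectation (\<lambda>\<omega>. (\<Sum>i\<in>I. X i \<omega>)\<^sup>2) \<le> real (card I) * c\<^sup>2"
proof -
  have [measurable]: "X i \<in> borel_measurable M" if "i \<in> I" for i
    using indep that by (auto simp: indep_vars_def)
  have int: "integrable M (X i)" if "i \<in> I" for i
    using that by (intro integrable_const_bound[of _ c]) (auto simp: bounded)
  have int2: "integrable M (\<lambda>\<omega>. X i \<omega> * X j \<omega>)" if "i \<in> I" "j \<in> I" for i j
    using that by (intro integrable_const_bound[of _ "c * c"])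
      (auto simp: abs_mult intro!: mult_mono bounded order_trans[OF abs_ge_zero bounded])
  have "expectation (\<lambda>\<omega>. (\<Sum>i\<in>I. X i \<omega>)\<^sup>2) = (\<Sum>i\<in>I. \<Sum>j\<in>I. expectation (\<lambda>\<omega>. X i \<omega> * X j \<omega>))"
    using int2 by (simp add: power2_eq_square sum_product Bochner_Integration.integral_sum)
  also have "\<dots> = (\<Sum>i\<in>I. \<Sum>j\<in>I. if i = j then expectation (\<lambda>\<omega>. (X i \<omega>)\<^sup>2) else 0)"
    using expectation_mult_indep_vars[OF indep int] centered
    by (intro sum.cong refl) (auto simp: power2_eq_square)
  also have "\<dots> = (\<Sum>i\<in>I. expectation (\<lambda>\<omega>. (X i \<omega>)\<^sup>2))"
    using I by simp
  also have "\<dots> \<le> (\<Sum>i\<in>I. c\<^sup>2)"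
  proof (rule sum_mono)
    fix i assume i: "i \<in> I"
    have "expectation (\<lambda>\<omega>. (X i \<omega>)\<^sup>2) \<le> expectation (\<lambda>\<omega>. c\<^sup>2)"
    proof (rule integral_mono)
      show "(X i \<omega>)\<^sup>2 \<le> c\<^sup>2" for \<omega>
        using bounded[OF i] by (simp add: abs_le_square_iff[symmetric] order_trans[OF _ abs_ge_self])
    qed (use int2[OF i i] in \<open>auto simp: power2_eq_square\<close>)
    then show "expectation (\<lambda>\<omega>. (X i \<omega>)\<^sup>2) \<le> c\<^sup>2"
      by (simp add: prob_space)
  qed
  finally show ?thesis
    by simp
qed

section \<open>Truncation of integrable random variables\<close>

definition cutoff :: "real \<Rightarrow> real \<Rightarrow> real" where
  "cutoff c x = (if \<bar>x\<bar> \<le> c then x else 0)"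

lemma measurable_cutoff [measurable]: "cutoff c \<in> borel_measurable borel"
  unfolding cutoff_def[abs_def] by measurable

text \<open>At each point the error vanishes as soon as \<open>n\<close> exceeds the value there,
  and it is always dominated by \<open>\<bar>X \<omega>\<bar>\<close>.\<close>

lemma (in prob_space) cutoff_tendsto_L1:
  fixes X :: "'a \<Rightarrow> real"
  assumes X: "integrable M X"
  shows "(\<lambda>n. expectation (\<lambda>\<omega>. \<bar>X \<omega> - cutoff (real n) (X \<omega>)\<bar>)) \<longlonglongrightarrow> 0"
proof -
  have [measurable]: "X \<in> borel_measurable M"
    using X by simp
  have "(\<lambda>n. expectation (\<lambda>\<omega>. \<bar>X \<omega> - cutoff (real n) (X \<omega>)\<bar>)) \<longlonglongrightarrow> expectation (\<lambda>\<omega>. 0)"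
  proof (rule integral_dominated_convergence[where w = "\<lambda>\<omega>. \<bar>X \<omega>\<bar>"])
    have "(\<lambda>n. \<bar>X \<omega> - cutoff (real n) (X \<omega>)\<bar>) \<longlonglongrightarrow> 0" for \<omega>
      using eventually_ge_at_top[of "nat \<lceil>\<bar>X \<omega>\<bar>\<rceil>"]
      by (intro tendsto_eventually, eventually_elim) (simp add: cutoff_def nat_ceiling_le_eq)
    then show "AE \<omega> in M. (\<lambda>n. \<bar>X \<omega> - cutoff (real n) (X \<omega>)\<bar>) \<longlonglongrightarrow> 0"
      by simp
  qed (use X in \<open>auto simp: cutoff_def\<close>)
  then show ?thesis
    by simp
qed

lemma integrable_cong_distr:
  fixes h :: "'b \<Rightarrow> real"
  assumes "distr M N X = distr M N Y" "X \<in> measurable M N" "Y \<in> measurable M N" "h \<in> borel_measurable N"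
  shows "integrable M (\<lambda>\<omega>. h (X \<omega>)) \<longleftrightarrow> integrable M (\<lambda>\<omega>. h (Y \<omega>))"
  using assms by (metis integrable_distr_eq)

lemma integral_cong_distr:
  fixes h :: "'b \<Rightarrow> real"
  assumes "distr M N X = distr M N Y" "X \<in> measurable M N" "Y \<in> measurable M N" "h \<in> borel_measurable N"
  shows "(\<integral>\<omega>. h (X \<omega>) \<partial>M) = (\<integral>\<omega>. h (Y \<omega>) \<partial>M)"
  using assms by (metis integral_distr)

text \<open>
  Truncating at level \<open>c\<close> splits the average into a part with second moment \<open>O(1/n)\<close> and a
  part that is uniformly small in \<open>L\<^sub>1\<close>.
\<close>

lemma (in prob_space) weak_law_of_large_numbers_L1:
  fixes X :: "nat \<Rightarrow> 'a \<Rightarrow> real"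
  assumes indep: "indep_vars (\<lambda>_. borel) X {1..}"
    and ident: "\<And>k. k \<ge> 1 \<Longrightarrow> distr M borel (X k) = distr M borel (X 1)"
    and int1: "integrable M (X 1)"
  shows "(\<lambda>n. expectation (\<lambda>\<omega>. \<bar>(\<Sum>k=1..n. X k \<omega>) / n - expectation (X 1)\<bar>)) \<longlonglongrightarrow> 0"
proof (rule LIMSEQ_I)
  fix e :: real assume e: "e > 0"
  have meas: "X k \<in> borel_measurable M" if "k \<ge> 1" for k
    using indep that by (auto simp: indep_vars_def)
  have same: "expectation (\<lambda>\<omega>. h (X k \<omega>)) = expectation (\<lambda>\<omega>. h (X 1 \<omega>))"
    if "k \<ge> 1" "h \<in> borel_measurable borel" for k and h :: "real \<Rightarrow> real"
    using that by (intro integral_cong_distr[OF ident meas meas]) auto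
  have int: "integrable M (X k)" if "k \<ge> 1" for k
    using integrable_cong_distr[OF ident[OF that] meas[OF that] meas, of "\<lambda>x. x"] int1 by simp
  \<comment> \<open>The truncation error is paid twice, in the average and in the mean; two quarters
    of \<open>e\<close> leave \<open>e / 2\<close> for the bounded part.\<close>
  obtain c :: nat where c: "expectation (\<lambda>\<omega>. \<bar>X 1 \<omega> - cutoff c (X 1 \<omega>)\<bar>) < e / 4"
    using order_tendstoD(2)[OF cutoff_tendsto_L1[OF int1], of "e / 4"] e
    by (auto simp: eventually_sequentially)
  define m where "m = expectation (X 1)"
  define m' where "m' = expectation (\<lambda>\<omega>. cutoff c (X 1 \<omega>))"
  \<comment> \<open>Truncation may move the mean from \<open>m\<close> to \<open>m'\<close>, so the
    truncated variables are centered at \<open>m'\<close> and \<open>m' - m\<close> is estimated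
    separately.\<close>
  define Y where "Y k \<omega> = cutoff c (X k \<omega>) - m'" for k \<omega>
  have int_cut: "integrable M (\<lambda>\<omega>. cutoff c (X k \<omega>))" if "k \<ge> 1" for k
    using meas[OF that] by (intro integrable_const_bound[of _ c]) (auto simp: cutoff_def)
  have m': "\<bar>m'\<bar> \<le> c"
  proof -
    have "\<bar>m'\<bar> \<le> expectation (\<lambda>\<omega>. \<bar>cutoff c (X 1 \<omega>)\<bar>)"
      unfolding m'_def by (rule integral_abs_bound)
    also have "\<dots> \<le> expectation (\<lambda>\<omega>. c)"
      using int_cut[of 1] by (intro integral_mono) (auto simp: cutoff_def)
    finally show ?thesis
      by (simp add: prob_space)
  qed
  have Y_bound: "\<bar>Y k \<omega>\<bar> \<le> 2 * c" for k \<omega>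
    using m' by (auto simp: Y_def cutoff_def)
  have Y_int: "integrable M (Y k)" and Y_mean: "expectation (Y k) = 0" if "k \<ge> 1" for k
    using int_cut[OF that] same[OF that measurable_cutoff[of c]]
    by (auto simp: Y_def[abs_def] m'_def prob_space)
  have Y_indep: "indep_vars (\<lambda>_. borel) Y {1..n}" for n
    using indep_vars_compose2[OF indep_vars_subset[OF indep, of "{1..n}"], of "\<lambda>_ x. cutoff c x - m'" "\<lambda>_. borel"]
    by (auto simp: Y_def[abs_def])
  have Y_sum_int: "integrable M (\<lambda>\<omega>. \<Sum>k=1..n. Y k \<omega>)" for n
    using Y_int by (intro Bochner_Integration.integrable_sum) auto
  \<comment> \<open>Growth of order \<open>sqrt n\<close> is what division by \<open>n\<close> later
    turns into a null sequence.\<close>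
  have Y_sum: "expectation (\<lambda>\<omega>. \<bar>\<Sum>k=1..n. Y k \<omega>\<bar>) \<le> sqrt n * (2 * c)" for n
  proof -
    have Y_sum_bound: "\<bar>\<Sum>k=1..n. Y k \<omega>\<bar> \<le> real n * (2 * c)" for \<omega>
      using order_trans[OF sum_abs sum_bounded_above[of "{1..n}" "\<lambda>k. \<bar>Y k \<omega>\<bar>" "2 * c", OF Y_bound]]
      by simp
    have "integrable M (\<lambda>\<omega>. (\<Sum>k=1..n. Y k \<omega>)\<^sup>2)"
      using Y_sum_bound Y_sum_int[of n]
      by (intro integrable_const_bound[of _ "(real n * (2 * c))\<^sup>2"])
        (auto intro!: AE_I2 power2_le_iff_abs_le[THEN iffD2])
    then have "expectation (\<lambda>\<omega>. \<bar>\<Sum>k=1..n. Y k \<omega>\<bar>) \<le> sqrt (expectation (\<lambda>\<omega>. (\<Sum>k=1..n. Y k \<omega>)\<^sup>2))"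
      by (rule expectation_abs_le_sqrt[OF Y_sum_int])
    also have "\<dots> \<le> sqrt (n * (2 * c)\<^sup>2)"
      using expectation_sum_sq_indep_centered[OF Y_indep[of n] _ Y_bound Y_mean] by simp
    also have "\<dots> = sqrt n * (2 * c)"
      by (simp add: real_sqrt_mult)
    finally show ?thesis .
  qed
  have "\<bar>m' - m\<bar> \<le> e / 4"
  proof -
    have "m' - m = expectation (\<lambda>\<omega>. cutoff c (X 1 \<omega>) - X 1 \<omega>)"
      using int_cut[of 1] int1 by (simp add: m_def m'_def)
    also have "\<bar>\<dots>\<bar> \<le> expectation (\<lambda>\<omega>. \<bar>cutoff c (X 1 \<omega>) - X 1 \<omega>\<bar>)"
      by (rule integral_abs_bound)
    finally show ?thesis
      using c by (simp add: abs_minus_commute)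
  qed
  note mm = this
  have bound: "expectation (\<lambda>\<omega>. \<bar>(\<Sum>k=1..n. X k \<omega>) / n - m\<bar>) \<le> e / 2 + 2 * c / sqrt n" if n: "n \<ge> 1" for n
  proof -
    define Z where "Z k \<omega> = \<bar>X k \<omega> - cutoff c (X k \<omega>)\<bar>" for k \<omega>
    have Z_int: "integrable M (Z k)" if "k \<ge> 1" for k
      using int[OF that] int_cut[OF that] by (simp add: Z_def[abs_def])
    have Z_mean: "expectation (Z k) \<le> e / 4" if "k \<ge> 1" for k
      using same[OF that, of "\<lambda>x. \<bar>x - cutoff c x\<bar>"] c by (simp add: Z_def[abs_def])
    have pointwise: "\<bar>(\<Sum>k=1..n. X k \<omega>) / n - m\<bar>
        \<le> (\<Sum>k=1..n. Z k \<omega>) / n + \<bar>\<Sum>k=1..n. Y k \<omega>\<bar> / n + e / 4" for \<omega>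
    proof -
      \<comment> \<open>Centering subtracts \<open>n * m' / n\<close>, which equals
        \<open>m'\<close> for \<open>n \<ge> 1\<close>; with \<open>x / 0 = 0\<close> the identity
        could fail at \<open>n = 0\<close>.\<close>
      have "(\<Sum>k=1..n. X k \<omega>) / n - m
          = (\<Sum>k=1..n. X k \<omega> - cutoff c (X k \<omega>)) / n + (\<Sum>k=1..n. Y k \<omega>) / n + (m' - m)"
        using n by (simp add: Y_def sum_subtractf field_simps)
      also have "\<bar>\<dots>\<bar> \<le> \<bar>\<Sum>k=1..n. X k \<omega> - cutoff c (X k \<omega>)\<bar> / n + \<bar>\<Sum>k=1..n. Y k \<omega>\<bar> / n + \<bar>m' - m\<bar>"
        by (intro order_trans[OF abs_triangle_ineq] add_mono) (simp_all add: abs_divide)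
      also have "\<dots> \<le> (\<Sum>k=1..n. Z k \<omega>) / n + \<bar>\<Sum>k=1..n. Y k \<omega>\<bar> / n + e / 4"
        unfolding Z_def by (intro add_mono divide_right_mono sum_abs mm) auto
      finally show ?thesis .
    qed
    have "expectation (\<lambda>\<omega>. \<bar>(\<Sum>k=1..n. X k \<omega>) / n - m\<bar>)
        \<le> expectation (\<lambda>\<omega>. (\<Sum>k=1..n. Z k \<omega>) / n + \<bar>\<Sum>k=1..n. Y k \<omega>\<bar> / n + e / 4)"
      using pointwise int Z_int Y_sum_int[of n]
      by (intro integral_mono) (auto intro!: Bochner_Integration.integrable_add Bochner_Integration.integrable_sum
          Bochner_Integration.integrable_diff integrable_divide)
    also have "\<dots> = (\<Sum>k=1..n. expectation (Z k)) / n + expectation (\<lambda>\<omega>. \<bar>\<Sum>k=1..n. Y k \<omega>\<bar>) / n + e / 4"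
      using Z_int Y_sum_int[of n]
      by (subst Bochner_Integration.integral_add Bochner_Integration.integral_sum | 
          auto intro!: Bochner_Integration.integrable_add Bochner_Integration.integrable_sum simp: prob_space)+
    also have "\<dots> \<le> (\<Sum>k=1..n. e / 4) / n + sqrt n * (2 * c) / n + e / 4"
      using Z_mean by (intro add_mono divide_right_mono sum_mono Y_sum) auto
    also have "\<dots> = e / 2 + 2 * c / sqrt n"
      using n by (simp add: field_simps)
    finally show ?thesis .
  qed
  have "(\<lambda>n. 2 * c / sqrt (real n)) \<longlonglongrightarrow> 0"
    by (intro tendsto_divide_0[OF tendsto_const] filterlim_at_top_imp_at_infinity
        filterlim_compose[OF sqrt_at_top filterlim_real_sequentially])
  then have "\<forall>\<^sub>F n in sequentially. 2 * c / sqrt (real n) < e / 2"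
    using e by (intro order_tendstoD) auto
  then obtain N where N: "\<And>n. n \<ge> N \<Longrightarrow> 2 * c / sqrt (real n) < e / 2"
    by (auto simp: eventually_sequentially)
  have "norm (expectation (\<lambda>\<omega>. \<bar>(\<Sum>k=1..n. X k \<omega>) / n - m\<bar>) - 0) < e" if "n \<ge> max 1 N" for n
  proof -
    have "0 \<le> expectation (\<lambda>\<omega>. \<bar>(\<Sum>k=1..n. X k \<omega>) / n - m\<bar>)"
      by (rule integral_nonneg_AE) simp
    then show ?thesis
      using bound[of n] N[of n] that by simp
  qed
  then show "\<exists>N. \<forall>n\<ge>N. norm (expectation (\<lambda>\<omega>. \<bar>(\<Sum>k=1..n. X k \<omega>) / n - expectation (X 1)\<bar>) - 0) < e"
    unfolding m_def by blast
qed

text \<open>The Euclidean norm is at most the sum of the absolute coordinates, of which there are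
  finitely many, and the scalar law treats each. The factor \<open>1 / n\<close> stays inside the
  sum to match the shift vectors \<open>\<xi> k \<omega> /\<^sub>R real n\<close>.\<close>

lemma (in prob_space) weak_law_of_large_numbers_L1_vec:
  fixes \<xi> :: "nat \<Rightarrow> 'a \<Rightarrow> real ^ 'd"
  assumes indep: "indep_vars (\<lambda>_. borel) \<xi> {1..}"
    and ident: "\<And>k. k \<ge> 1 \<Longrightarrow> distr M borel (\<xi> k) = distr M borel (\<xi> 1)"
    and int1: "integrable M (\<xi> 1)"
  shows "\<And>n. integrable M (\<lambda>\<omega>. (\<Sum>k=1..n. \<xi> k \<omega> /\<^sub>R real n))"
    and "(\<lambda>n. expectation (\<lambda>\<omega>. norm ((\<Sum>k=1..n. \<xi> k \<omega> /\<^sub>R real n) - expectation (\<xi> 1)))) \<longlonglongrightarrow> 0"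
proof -
  have meas: "\<xi> k \<in> borel_measurable M" if "k \<ge> 1" for k
    using indep that by (auto simp: indep_vars_def)
  \<comment> \<open>Equality in distribution is transferred for real-valued functions, so
    integrability of the vector passes through its norm.\<close>
  have int: "integrable M (\<xi> k)" if "k \<ge> 1" for k
    using integrable_cong_distr[OF ident[OF that] meas[OF that] meas, of norm] int1 meas[OF that]
    by (simp add: integrable_norm_iff)
  show avg_int: "integrable M (\<lambda>\<omega>. (\<Sum>k=1..n. \<xi> k \<omega> /\<^sub>R real n))" for n
    using int by (intro Bochner_Integration.integrable_sum integrable_scaleR_right) auto
  have nth: "integrable M (\<lambda>\<omega>. f \<omega> $ i)" "expectation (\<lambda>\<omega>. f \<omega> $ i) = expectation f $ i"
    if "integrable M f" for f :: "'a \<Rightarrow> real ^ 'd" and i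
    using integrable_bounded_linear[OF bounded_linear_vec_nth that]
      integral_bounded_linear[OF bounded_linear_vec_nth that] by auto
  define D where "D n i = expectation (\<lambda>\<omega>. \<bar>(\<Sum>k=1..n. \<xi> k \<omega> $ i) / n - expectation (\<xi> 1) $ i\<bar>)" for n i
  have D: "(\<lambda>n. D n i) \<longlonglongrightarrow> 0" for i
  proof -
    have [measurable]: "(\<lambda>x :: real ^ 'd. x $ i) \<in> borel_measurable borel"
      by (intro borel_measurable_continuous_onI continuous_intros)
    have "indep_vars (\<lambda>_. borel) (\<lambda>k \<omega>. \<xi> k \<omega> $ i) {1..}"
      by (rule indep_vars_compose2[OF indep]) measurable
    moreover have "distr M borel (\<lambda>\<omega>. \<xi> k \<omega> $ i) = distr M borel (\<lambda>\<omega>. \<xi> 1 \<omega> $ i)" if "k \<ge> 1" for k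
    proof -
      have "distr M borel (\<lambda>\<omega>. \<xi> k \<omega> $ i) = distr (distr M borel (\<xi> k)) borel (\<lambda>x. x $ i)" if "k \<ge> 1" for k
        using meas[OF that] by (simp add: distr_distr o_def)
      then show ?thesis
        using that ident[OF that] by simp
    qed
    moreover have "integrable M (\<lambda>\<omega>. \<xi> 1 \<omega> $ i)"
      by (rule nth(1)[OF int1])
    ultimately have "(\<lambda>n. expectation (\<lambda>\<omega>. \<bar>(\<Sum>k=1..n. \<xi> k \<omega> $ i) / n - expectation (\<lambda>\<omega>. \<xi> 1 \<omega> $ i)\<bar>))
        \<longlonglongrightarrow> 0"
      by (rule weak_law_of_large_numbers_L1[of "\<lambda>k \<omega>. \<xi> k \<omega> $ i"])
    then show ?thesis
      unfolding D_def nth(2)[OF int1] .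
  qed
  have "expectation (\<lambda>\<omega>. norm ((\<Sum>k=1..n. \<xi> k \<omega> /\<^sub>R real n) - expectation (\<xi> 1))) \<le> (\<Sum>i\<in>UNIV. D n i)" for n
  proof -
    have int_i: "integrable M (\<lambda>\<omega>. (\<Sum>k=1..n. \<xi> k \<omega> $ i) / n - expectation (\<xi> 1) $ i)" for i
      using nth int by (intro Bochner_Integration.integrable_diff integrable_divide Bochner_Integration.integrable_sum) auto
    have "expectation (\<lambda>\<omega>. norm ((\<Sum>k=1..n. \<xi> k \<omega> /\<^sub>R real n) - expectation (\<xi> 1)))
        \<le> expectation (\<lambda>\<omega>. \<Sum>i\<in>UNIV. \<bar>(\<Sum>k=1..n. \<xi> k \<omega> $ i) / n - expectation (\<xi> 1) $ i\<bar>)"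
    proof (rule integral_mono)
      show "norm ((\<Sum>k=1..n. \<xi> k \<omega> /\<^sub>R real n) - expectation (\<xi> 1))
          \<le> (\<Sum>i\<in>UNIV. \<bar>(\<Sum>k=1..n. \<xi> k \<omega> $ i) / n - expectation (\<xi> 1) $ i\<bar>)" for \<omega>
        using norm_le_l1_cart[of "(\<Sum>k=1..n. \<xi> k \<omega> /\<^sub>R real n) - expectation (\<xi> 1)"]
        by (simp add: sum_divide_distrib field_simps)
      show "integrable M (\<lambda>\<omega>. norm ((\<Sum>k=1..n. \<xi> k \<omega> /\<^sub>R real n) - expectation (\<xi> 1)))"
        using avg_int by (intro integrable_norm Bochner_Integration.integrable_diff) auto
      show "integrable M (\<lambda>\<omega>. \<Sum>i\<in>UNIV. \<bar>(\<Sum>k=1..n. \<xi> k \<omega> $ i) / n - expectation (\<xi> 1) $ i\<bar>)"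
        using int_i by (intro Bochner_Integration.integrable_sum integrable_abs)
    qed
    also have "\<dots> = (\<Sum>i\<in>UNIV. D n i)"
      unfolding D_def using int_i by (intro Bochner_Integration.integral_sum integrable_abs)
    finally show ?thesis .
  qed
  note le = this
  have lim: "(\<lambda>n. \<Sum>i\<in>UNIV. D n i) \<longlonglongrightarrow> 0"
    using tendsto_sum[of UNIV "\<lambda>i n. D n i" "\<lambda>_. 0"] D by simp
  show "(\<lambda>n. expectation (\<lambda>\<omega>. norm ((\<Sum>k=1..n. \<xi> k \<omega> /\<^sub>R real n) - expectation (\<xi> 1)))) \<longlonglongrightarrow> 0"
    by (rule tendsto_sandwich[OF always_eventually always_eventually tendsto_const lim])
      (intro allI le integral_nonneg_AE AE_I2 norm_ge_zero)+
qed

section \<open>From convergence of averages to bounded continuous functions of them\<close>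

lemma (in prob_space) expectation_continuous_tendsto:
  fixes X :: "nat \<Rightarrow> 'a \<Rightarrow> 'b::euclidean_space" and \<phi> :: "'b \<Rightarrow> complex"
  assumes X: "\<And>n. integrable M (X n)" and lim: "(\<lambda>n. expectation (\<lambda>\<omega>. norm (X n \<omega> - \<mu>))) \<longlonglongrightarrow> 0"
    and cont: "continuous_on UNIV \<phi>" and bounded: "\<And>x. cmod (\<phi> x) \<le> C"
  shows "\<And>n. integrable M (\<lambda>\<omega>. \<phi> (X n \<omega>))"
    and "(\<lambda>n. expectation (\<lambda>\<omega>. cmod (\<phi> (X n \<omega>) - \<phi> \<mu>))) \<longlonglongrightarrow> 0"
proof -
  have [measurable]: "X n \<in> borel_measurable M" for n
    using X by auto
  have [measurable]: "\<phi> \<in> borel_measurable borel"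
    by (rule borel_measurable_continuous_onI[OF cont])
  show int: "integrable M (\<lambda>\<omega>. \<phi> (X n \<omega>))" for n
    by (rule integrable_const_bound[of _ C]) (auto simp: bounded)
  show "(\<lambda>n. expectation (\<lambda>\<omega>. cmod (\<phi> (X n \<omega>) - \<phi> \<mu>))) \<longlonglongrightarrow> 0"
  proof (rule tendstoI)
    fix e :: real assume e: "e > 0"
    have "C \<ge> 0"
      using order_trans[OF norm_ge_zero bounded] by blast
    obtain \<delta> where \<delta>: "\<delta> > 0" "\<And>x. dist x \<mu> < \<delta> \<Longrightarrow> dist (\<phi> x) (\<phi> \<mu>) < e / 2"
      using cont e unfolding continuous_on_iff by (metis UNIV_I half_gt_zero)
    \<comment> \<open>Within \<delta> of \<mu> the first summand suffices. Farther away the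
      difference is at most \<open>2 * C\<close>, and
      \<open>norm (x - \<mu>) / \<delta> \<ge> 1\<close> explains the coefficient
      \<open>2 * C / \<delta>\<close>.\<close>
    have pointwise: "cmod (\<phi> x - \<phi> \<mu>) \<le> e / 2 + 2 * C / \<delta> * norm (x - \<mu>)" for x
    proof (cases "dist x \<mu> < \<delta>")
      case True
      have "cmod (\<phi> x - \<phi> \<mu>) \<le> e / 2"
        using \<delta>(2)[OF True] by (simp add: dist_norm)
      also have "\<dots> \<le> e / 2 + 2 * C / \<delta> * norm (x - \<mu>)"
        using \<open>C \<ge> 0\<close> \<delta>(1) by simp
      finally show ?thesis .
    next
      case False
      have "cmod (\<phi> x - \<phi> \<mu>) \<le> 2 * C"
        using norm_triangle_ineq4[of "\<phi> x" "\<phi> \<mu>"] bounded[of x] bounded[of \<mu>] by linarith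
      also have "\<dots> = 2 * C / \<delta> * \<delta>"
        using \<delta>(1) by simp
      also have "\<dots> \<le> 2 * C / \<delta> * norm (x - \<mu>)"
        using False \<open>C \<ge> 0\<close> \<delta>(1) by (intro mult_left_mono) (auto simp: dist_norm)
      finally show ?thesis
        using e by simp
    qed
    have int_norm: "integrable M (\<lambda>\<omega>. norm (X n \<omega> - \<mu>))" for n
      using X by (intro integrable_norm Bochner_Integration.integrable_diff) auto
    have bound: "expectation (\<lambda>\<omega>. cmod (\<phi> (X n \<omega>) - \<phi> \<mu>))
        \<le> e / 2 + 2 * C / \<delta> * expectation (\<lambda>\<omega>. norm (X n \<omega> - \<mu>))" for n
    proof -
      have "expectation (\<lambda>\<omega>. cmod (\<phi> (X n \<omega>) - \<phi> \<mu>))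
          \<le> expectation (\<lambda>\<omega>. e / 2 + 2 * C / \<delta> * norm (X n \<omega> - \<mu>))"
        using int int_norm[of n] by (intro integral_mono pointwise) auto
      also have "\<dots> = e / 2 + 2 * C / \<delta> * expectation (\<lambda>\<omega>. norm (X n \<omega> - \<mu>))"
        using int_norm[of n] by (simp add: prob_space)
      finally show ?thesis .
    qed
    have "(\<lambda>n. e / 2 + 2 * C / \<delta> * expectation (\<lambda>\<omega>. norm (X n \<omega> - \<mu>))) \<longlonglongrightarrow> e / 2 + 2 * C / \<delta> * 0"
      by (intro tendsto_intros lim)
    then have "\<forall>\<^sub>F n in sequentially. e / 2 + 2 * C / \<delta> * expectation (\<lambda>\<omega>. norm (X n \<omega> - \<mu>)) < e"
      using e by (intro order_tendstoD(2)[where y = "e / 2 + 2 * C / \<delta> * 0"]) auto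
    then show "\<forall>\<^sub>F n in sequentially. dist (expectation (\<lambda>\<omega>. cmod (\<phi> (X n \<omega>) - \<phi> \<mu>))) 0 < e"
    proof eventually_elim
      case (elim n)
      have "0 \<le> expectation (\<lambda>\<omega>. cmod (\<phi> (X n \<omega>) - \<phi> \<mu>))"
        by (rule integral_nonneg_AE) simp
      with bound[of n] elim show ?case
        by simp
    qed
  qed
qed

subsection \<open>Convergence of the pure states\<close>

theorem theorem4p6:
  fixes M :: "'w measure"
    and \<xi> :: "nat \<Rightarrow> 'w \<Rightarrow> real ^ 'd"
    and \<mu> :: "real ^ 'd"
    and u :: "(real ^ 'd) L2"
  assumes "prob_space M"
    and "prob_space.indep_vars M (\<lambda>_. borel) \<xi> {1..}"
    and "\<And>k. k \<ge> 1 \<Longrightarrow> distr M borel (\<xi> k) = distr M borel (\<xi> 1)"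
    and "integrable M (\<xi> 1)"
    and "(\<integral>\<omega>. \<xi> 1 \<omega> \<partial>M) = \<mu>"
  shows "tendsto_state_wot_L1 M
           (\<lambda>n \<omega>. pure_state (shift_prod (\<lambda>k. \<xi> k \<omega> /\<^sub>R real n) n u))
           (pure_state (shift_op \<mu> u))"
  unfolding tendsto_state_wot_L1_def
proof (intro allI impI)
  interpret prob_space M by fact
  fix A :: "(real ^ 'd) L2 \<Rightarrow> (real ^ 'd) L2"
  assume A: "bounded_clinear A"
  then interpret A: bounded_linear A
    by (simp add: bounded_clinear_def)
  obtain K where K: "\<And>v. norm (A v) \<le> norm v * K"
    using A.bounded by blast
  define \<phi> where "\<phi> a = cinner (shift_op a u) (A (shift_op a u))" for a
  have cont: "continuous_on UNIV \<phi>"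
    unfolding \<phi>_def by (intro continuous_intros continuous_on_shift_op A.continuous_on)
  \<comment> \<open>Isometry of shifts makes the bound independent of \<open>a\<close>; the 2 is the
    factor from \<open>norm_cinner_le\<close>.\<close>
  have bounded: "cmod (\<phi> a) \<le> 2 * norm u * (norm u * K)" for a
    unfolding \<phi>_def using K[of "shift_op a u"]
    by (intro order_trans[OF norm_cinner_le]) (simp add: norm_shift_op mult_left_mono)
  \<comment> \<open>These facts also cover \<open>n = 0\<close>: the empty sum is the zero vector
    and the corresponding shift is the identity.\<close>
  note average = weak_law_of_large_numbers_L1_vec[OF assms(2-4)]
  note lim = expectation_continuous_tendsto[OF average[unfolded assms(5)] cont bounded]
  show "(\<forall>n. integrable M (\<lambda>\<omega>. trace_op (pure_state (shift_prod (\<lambda>k. \<xi> k \<omega> /\<^sub>R real n) n u) \<circ> A))) \<and>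
      (\<lambda>n. \<integral>\<omega>. cmod (trace_op (pure_state (shift_prod (\<lambda>k. \<xi> k \<omega> /\<^sub>R real n) n u) \<circ> A)
        - trace_op (pure_state (shift_op \<mu> u) \<circ> A)) \<partial>M) \<longlonglongrightarrow> 0"
    using lim by (simp add: trace_pure_state[OF A] shift_prod_eq \<phi>_def)
qed

end
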